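(* Let $\mathcal{M}\colon A\to B$ and $\mathcal{N}\colon A\to B'$ be quantum channels, let $\sigma_{RA}$ be a quantum state, and let $\eta\geq 0$. Then the following are equivalent: (i) For all classical-quantum states $\rho_{RUA}$ with marginal $\rho_{RA}=\sigma_{RA}$, where $U$ is a classical system of dimension $|U|=2$, $$\eta\, I(U:B|R)\geq I(U:B'|R).$$ (ii) For all classical-quantum states $\rho_{RUA}$ with marginal $\rho_{RA}=\sigma_{RA}$, where $U$ is an arbitrary (finite) classical system, $$\eta\, I(U:B|R)\geq I(U:B'|R).$$ (iii) For every quantum state $\rho_{RA}$ satisfying $\operatorname{supp}(\rho_{RA})\subseteq\operatorname{supp}(\sigma_{RA})$, $$\eta\left[D(\mathcal{M}(\rho_{RA})\|\mathcal{M}(\sigma_{RA}))-D(\rho_R\|\sigma_R)\right]\geq D(\mathcal{N}(\rho_{RA})\|\mathcal{N}(\sigma_{RA}))-D(\rho_R\|\sigma_R).$$ In (i) and (ii), the conditional mutual informations on the left-hand side are evaluated on the state $\mathcal{M}(\rho_{RUA})$ and those on the right-hand side on $\mathcal{N}(\rho_{RUA})$.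
   Context: All systems are finite-dimensional. Channels are completely positive trace-preserving maps; a channel on $A$ applied to a state of a larger system acts as the identity on the other systems, e.g. $\mathcal{N}(\rho_{RA})\equiv(\operatorname{id}_R\otimes\mathcal{N})(\rho_{RA})$. $D(\rho\|\sigma)=\operatorname{Tr}[\rho(\log\rho-\log\sigma)]$ if $\operatorname{supp}(\rho)\subseteq\operatorname{supp}(\sigma)$ and $+\infty$ otherwise. $I(A:B)=D(\rho_{AB}\|\rho_A\otimes\rho_B)$ and $I(A:B|C)=I(A:BC)-I(A:C)$. A classical-quantum state $\rho_{RUA}$ with $U$ classical has the form $\sum_u p(u)|u\rangle\langle u|_U\otimes\rho^u_{RA}$ with $(|u\rangle)_u$ an orthonormal basis, $p$ a probability distribution and $\rho^u_{RA}$ states. *)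

theory Defs
  imports
    Complex_Main
    "HOL-Library.Extended_Real"
    "Jordan_Normal_Form.Matrix_Kernel"
    "Jordan_Normal_Form.Schur_Decomposition"
begin

text \<open>A system of dimension \<open>d\<close> is \<open>\<complex>\<^sup>d\<close>; operators on it are matrices in
  \<open>carrier_mat d d\<close>. In a composite system \<open>X \<otimes> Y\<close> of dimension \<open>m * n\<close> the basis vector
  \<open>|i\<rangle> \<otimes> |a\<rangle>\<close> has index \<open>i * n + a\<close>. This encoding is associative, so a tripartite system
  \<open>X \<otimes> Y \<otimes> Z\<close> may be read as \<open>(X \<otimes> Y) \<otimes> Z\<close> or as \<open>X \<otimes> (Y \<otimes> Z)\<close>.\<close>

definition mat_trace :: "complex mat \<Rightarrow> complex" where
  "mat_trace A = (\<Sum>i<dim_row A. A $$ (i, i))"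

definition kron :: "complex mat \<Rightarrow> complex mat \<Rightarrow> complex mat" where
  "kron A B = mat (dim_row A * dim_row B) (dim_col A * dim_col B)
     (\<lambda>(i, j). A $$ (i div dim_row B, j div dim_col B) * B $$ (i mod dim_row B, j mod dim_col B))"

definition ptrace_fst :: "nat \<Rightarrow> nat \<Rightarrow> complex mat \<Rightarrow> complex mat" where
  "ptrace_fst m n X = mat n n (\<lambda>(a, b). \<Sum>i<m. X $$ (i * n + a, i * n + b))"

definition ptrace_snd :: "nat \<Rightarrow> nat \<Rightarrow> complex mat \<Rightarrow> complex mat" where
  "ptrace_snd m n X = mat m m (\<lambda>(i, j). \<Sum>a<n. X $$ (i * n + a, j * n + a))"

text \<open>Here \<open>\<ge>\<close> is the order of the complex numbers: the quadratic form is real and nonnegative.\<close>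

definition psd :: "nat \<Rightarrow> complex mat \<Rightarrow> bool" where
  "psd n A \<longleftrightarrow> A \<in> carrier_mat n n \<and> (\<forall>v\<in>carrier_vec n. (A *\<^sub>v v) \<bullet>c v \<ge> 0)"

definition quantum_state :: "nat \<Rightarrow> complex mat \<Rightarrow> bool" where
  "quantum_state n \<rho> \<longleftrightarrow> psd n \<rho> \<and> mat_trace \<rho> = 1"

text \<open>\<open>apply_snd k m n \<Phi>\<close> is \<open>id \<otimes> \<Phi>\<close>: writing an operator on \<open>\<complex>\<^sup>k \<otimes> \<complex>\<^sup>m\<close> as
  \<open>\<Sum>i j. |i\<rangle>\<langle>j| \<otimes> X\<^sub>i\<^sub>j\<close>, the map \<open>\<Phi>\<close> from \<open>m\<close>-dimensional to \<open>n\<close>-dimensional systems is applied to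
  each block \<open>X\<^sub>i\<^sub>j\<close>.\<close>

definition block :: "nat \<Rightarrow> complex mat \<Rightarrow> nat \<Rightarrow> nat \<Rightarrow> complex mat" where
  "block m X i j = mat m m (\<lambda>(a, b). X $$ (i * m + a, j * m + b))"

definition apply_snd ::
    "nat \<Rightarrow> nat \<Rightarrow> nat \<Rightarrow> (complex mat \<Rightarrow> complex mat) \<Rightarrow> complex mat \<Rightarrow> complex mat" where
  "apply_snd k m n \<Phi> X = mat (k * n) (k * n)
     (\<lambda>(i, j). \<Phi> (block m X (i div n) (j div n)) $$ (i mod n, j mod n))"

definition linear_map_mat :: "nat \<Rightarrow> nat \<Rightarrow> (complex mat \<Rightarrow> complex mat) \<Rightarrow> bool" where
  "linear_map_mat m n \<Phi> \<longleftrightarrow>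
     (\<forall>X\<in>carrier_mat m m. \<Phi> X \<in> carrier_mat n n) \<and>
     (\<forall>X\<in>carrier_mat m m. \<forall>Y\<in>carrier_mat m m. \<Phi> (X + Y) = \<Phi> X + \<Phi> Y) \<and>
     (\<forall>c. \<forall>X\<in>carrier_mat m m. \<Phi> (c \<cdot>\<^sub>m X) = c \<cdot>\<^sub>m \<Phi> X)"

definition completely_positive :: "nat \<Rightarrow> nat \<Rightarrow> (complex mat \<Rightarrow> complex mat) \<Rightarrow> bool" where
  "completely_positive m n \<Phi> \<longleftrightarrow>
     (\<forall>k X. psd (k * m) X \<longrightarrow> psd (k * n) (apply_snd k m n \<Phi> X))"

definition trace_preserving :: "nat \<Rightarrow> (complex mat \<Rightarrow> complex mat) \<Rightarrow> bool" where
  "trace_preserving m \<Phi> \<longleftrightarrow> (\<forall>X\<in>carrier_mat m m. mat_trace (\<Phi> X) = mat_trace X)"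

definition quantum_channel :: "nat \<Rightarrow> nat \<Rightarrow> (complex mat \<Rightarrow> complex mat) \<Rightarrow> bool" where
  "quantum_channel m n \<Phi> \<longleftrightarrow>
     linear_map_mat m n \<Phi> \<and> completely_positive m n \<Phi> \<and> trace_preserving m \<Phi>"

text \<open>The support of a Hermitian matrix is the orthogonal complement of its kernel.\<close>

definition supp :: "complex mat \<Rightarrow> complex vec set" where
  "supp A = {v \<in> carrier_vec (dim_col A). \<forall>w\<in>mat_kernel A. v \<bullet>c w = 0}"

definition unitary_mat :: "nat \<Rightarrow> complex mat \<Rightarrow> bool" where
  "unitary_mat n V \<longleftrightarrow> V \<in> carrier_mat n n \<and> mat_adjoint V * V = 1\<^sub>m n \<and> V * mat_adjoint V = 1\<^sub>m n"

text \<open>Functional calculus for Hermitian matrices. The result does not depend on the chosen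
  diagonalization, see \<open>mat_fun_eq\<close> below.\<close>

definition mat_fun :: "(real \<Rightarrow> real) \<Rightarrow> complex mat \<Rightarrow> complex mat" where
  "mat_fun f A = (THE B. \<exists>V d. unitary_mat (dim_row A) V \<and>
     A = V * mat_diag (dim_row A) (\<lambda>i. complex_of_real (d i)) * mat_adjoint V \<and>
     B = V * mat_diag (dim_row A) (\<lambda>i. complex_of_real (f (d i))) * mat_adjoint V)"

text \<open>The logarithm of a positive semidefinite matrix is taken on its support (\<open>0\<close> on the kernel).\<close>

definition mat_log :: "complex mat \<Rightarrow> complex mat" where
  "mat_log = mat_fun (\<lambda>x. if x > 0 then ln x else 0)"

definition rel_entropy :: "complex mat \<Rightarrow> complex mat \<Rightarrow> ereal" where
  "rel_entropy \<rho> \<sigma> =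
     (if supp \<rho> \<subseteq> supp \<sigma> then ereal (Re (mat_trace (\<rho> * (mat_log \<rho> - mat_log \<sigma>)))) else \<infinity>)"

text \<open>\<open>I(X:Y)\<close> for an operator on \<open>X \<otimes> Y\<close>, and \<open>I(X:Y|Z) = I(X:ZY) - I(X:Z)\<close> for an operator on
  \<open>X \<otimes> Z \<otimes> Y\<close>: the conditioning system is the middle factor.\<close>

definition mutual_info :: "nat \<Rightarrow> nat \<Rightarrow> complex mat \<Rightarrow> ereal" where
  "mutual_info dX dY \<rho> = rel_entropy \<rho> (kron (ptrace_snd dX dY \<rho>) (ptrace_fst dX dY \<rho>))"

definition cond_mutual_info :: "nat \<Rightarrow> nat \<Rightarrow> nat \<Rightarrow> complex mat \<Rightarrow> ereal" where
  "cond_mutual_info dX dZ dY \<rho> =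
     mutual_info dX (dZ * dY) \<rho> - mutual_info dX dZ (ptrace_snd (dX * dZ) dY \<rho>)"

definition orthonormal_basis :: "nat \<Rightarrow> (nat \<Rightarrow> complex vec) \<Rightarrow> bool" where
  "orthonormal_basis n e \<longleftrightarrow> (\<forall>u<n. e u \<in> carrier_vec n) \<and>
     (\<forall>u<n. \<forall>v<n. e u \<bullet>c e v = (if u = v then 1 else 0))"

definition ketbra :: "complex vec \<Rightarrow> complex mat" where
  "ketbra v = mat (dim_vec v) (dim_vec v) (\<lambda>(i, j). v $ i * cnj (v $ j))"

text \<open>Classical-quantum states on \<open>U \<otimes> Q\<close>, with \<open>U\<close> classical of dimension \<open>dU\<close> and \<open>Q\<close> of
  dimension \<open>n\<close>. The sum of matrices is written entrywise because \<open>mat\<close> carries no global zero.\<close>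

definition cq_state :: "nat \<Rightarrow> nat \<Rightarrow> complex mat \<Rightarrow> bool" where
  "cq_state dU n \<rho> \<longleftrightarrow> (\<exists>e p \<tau>.
     orthonormal_basis dU e \<and>
     (\<forall>u<dU. p u \<ge> (0::real)) \<and> (\<Sum>u<dU. p u) = 1 \<and>
     (\<forall>u<dU. quantum_state n (\<tau> u)) \<and>
     \<rho> = mat (dU * n) (dU * n)
           (\<lambda>ij. \<Sum>u<dU. (complex_of_real (p u) \<cdot>\<^sub>m kron (ketbra (e u)) (\<tau> u)) $$ ij))"

lemma mat_adjoint_carrier [simp]: "V \<in> carrier_mat n m \<Longrightarrow> mat_adjoint V \<in> carrier_mat m n"
  by (auto simp: mat_adjoint_def mat_of_rows_def)

lemma mat_fun_unique:
  assumes V: "unitary_mat n V" and W: "unitary_mat n W"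
    and eq: "V * mat_diag n (\<lambda>i. complex_of_real (d i)) * mat_adjoint V =
             W * mat_diag n (\<lambda>i. complex_of_real (c i)) * mat_adjoint W"
  shows "V * mat_diag n (\<lambda>i. complex_of_real (f (d i))) * mat_adjoint V =
         W * mat_diag n (\<lambda>i. complex_of_real (f (c i))) * mat_adjoint W"
proof -
  define D where "D g = mat_diag n (\<lambda>i. complex_of_real (g i))" for g :: "nat \<Rightarrow> real"
  define T where "T = mat_adjoint W * V"
  have [simp]: "V \<in> carrier_mat n n" "W \<in> carrier_mat n n" "D g \<in> carrier_mat n n" for g
    using V W by (auto simp: unitary_mat_def D_def)
  have [simp]: "mat_adjoint V \<in> carrier_mat n n" "mat_adjoint W \<in> carrier_mat n n"
    by auto
  have T [simp]: "T \<in> carrier_mat n n"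
    unfolding T_def by (rule mult_carrier_mat[of _ n n]) auto
  have VV: "mat_adjoint V * V = 1\<^sub>m n" "V * mat_adjoint V = 1\<^sub>m n"
    and WW: "mat_adjoint W * W = 1\<^sub>m n" "W * mat_adjoint W = 1\<^sub>m n"
    using V W by (auto simp: unitary_mat_def)
  have assoc: "(X * Y) * Z = X * (Y * Z)"
    if "X \<in> carrier_mat n n" "Y \<in> carrier_mat n n" "Z \<in> carrier_mat n n" for X Y Z :: "complex mat"
    using that by simp
  note mc = mult_carrier_mat[of _ n n _ n]
  have cancel: "W * (mat_adjoint W * X) = X" "mat_adjoint W * (W * X) = X"
      "V * (mat_adjoint V * X) = X" "mat_adjoint V * (V * X) = X"
    if "X \<in> carrier_mat n n" for X
    using that VV WW by (simp_all add: assoc[symmetric])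
  have "T * D d = mat_adjoint W * (V * D d * mat_adjoint V) * V"
    by (simp add: T_def assoc mc VV right_mult_one_mat[of _ n n])
  also have "\<dots> = mat_adjoint W * (W * D c * mat_adjoint W) * V"
    using eq by (simp add: D_def)
  also have "\<dots> = D c * T"
    by (simp add: T_def assoc mc cancel)
  finally have TD: "T * D d = D c * T" .
  have "T * D (f \<circ> d) = D (f \<circ> c) * T"
  proof (rule eq_matI)
    fix i j
    assume "i < dim_row (D (f \<circ> c) * T)" and "j < dim_col (D (f \<circ> c) * T)"
    then have ij: "i < n" "j < n"
      using T by (auto simp: D_def mat_diag_def)
    have "(T * D d) $$ (i, j) = (D c * T) $$ (i, j)"
      using TD by simp
    then have "T $$ (i, j) * d j = c i * T $$ (i, j)"
      using ij by (simp add: D_def mat_diag_mult_left[OF T] mat_diag_mult_right[OF T])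
    then have "T $$ (i, j) = 0 \<or> d j = c i"
      by (simp add: mult.commute)
    then show "(T * D (f \<circ> d)) $$ (i, j) = (D (f \<circ> c) * T) $$ (i, j)"
      using ij by (auto simp: D_def mat_diag_mult_left[OF T] mat_diag_mult_right[OF T])
  qed (simp_all add: D_def mat_diag_def carrier_matD[OF T])
  then have "W * (T * D (f \<circ> d)) * mat_adjoint V = W * (D (f \<circ> c) * T) * mat_adjoint V"
    by simp
  then have "V * D (f \<circ> d) * mat_adjoint V = W * D (f \<circ> c) * mat_adjoint W"
    by (simp add: T_def assoc mc cancel VV right_mult_one_mat[of _ n n])
  then show ?thesis
    by (simp add: D_def)
qed

lemma mat_fun_eq:
  assumes "unitary_mat n V"
    and "A = V * mat_diag n (\<lambda>i. complex_of_real (d i)) * mat_adjoint V"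
  shows "mat_fun f A = V * mat_diag n (\<lambda>i. complex_of_real (f (d i))) * mat_adjoint V"
proof -
  have "dim_row A = n"
    using assms by (auto simp: unitary_mat_def)
  then show ?thesis
    unfolding mat_fun_def using assms by (intro the_equality) (auto intro: mat_fun_unique)
qed

end

theory Submission
  imports Defs
begin

text \<open>For a classical-quantum state \<open>\<Sum>\<^sub>u p\<^sub>u |u\<rangle>\<langle>u| \<otimes> \<tau>\<^sub>u\<close> with marginal \<open>\<sigma>\<close>, the information
  \<open>I(U:B|R)\<close> is the average of \<open>D(M \<tau>\<^sub>u \<parallel> M \<sigma>) - D((\<tau>\<^sub>u)\<^sub>R \<parallel> \<sigma>\<^sub>R)\<close>, so the inequality in (ii) says that
  the difference \<open>G\<close> of the two sides of (iii) is nonnegative on average, whereas (iii) says that it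
  is nonnegative at every state supported in \<open>supp \<sigma>\<close>. For (i) implies (iii), write
  \<open>\<sigma> = \<lambda> \<rho> + (1 - \<lambda>) \<tau>\<close> with a small \<open>\<lambda>\<close>. Relative entropy vanishes to second order at coinciding
  arguments, so \<open>G(\<tau>) = O(\<lambda>\<^sup>2)\<close>, and \<open>\<lambda> G(\<rho>) + (1 - \<lambda>) G(\<tau>) \<ge> 0\<close> gives \<open>G(\<rho>) \<ge> 0\<close> in the limit
  \<open>\<lambda> \<rightarrow> 0\<close>.\<close>

section \<open>Spectral theorem\<close>

text \<open>The difficulty is that a state and its reference need not commute. Everything is
  therefore expressed in two eigenbases x_i, y_j with eigenvalues d_i, s_j: the weights |<x_i,
  y_j>|^2 form a doubly stochastic matrix, and relative entropies and Hilbert-Schmidt distances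
  become weighted double sums of scalar expressions in d_i and s_j. The second-order estimate is
  then a scalar inequality. Supports are handled through domination:
  \<open>supp \<rho> \<subseteq> supp \<sigma>\<close> holds iff \<sigma> - c \<rho> is positive
  semidefinite for some c > 0. This c bounds the weights \<lambda> admissible in the decomposition
  of \<sigma>, and since the condition is linear it survives every positive linear map, so that all
  relative entropies in (iii) are finite and G is a real number. G contains relative entropies with
  both signs. To bound G(\<tau>) from above, the negative ones are discarded by nonnegativity and
  the positive ones get the quadratic bound; its constant depends on the map, on \<sigma> and on the
  direction \<rho> - \<sigma>, but not on \<lambda>.\<close>

lemma mat_adjoint_index:
  assumes "V \<in> carrier_mat n m" "i < m" "j < n"
  shows "mat_adjoint V $$ (i, j) = cnj (V $$ (j, i))"
  using assms by (auto simp: mat_adjoint_def mat_of_rows_def)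

lemma mat_mult_index_sum:
  assumes "A \<in> carrier_mat m n" "B \<in> carrier_mat n k" "i < m" "j < k"
  shows "(A * B) $$ (i, j) = (\<Sum>l<n. A $$ (i, l) * B $$ (l, j))"
  using assms by (auto simp: scalar_prod_def atLeast0LessThan intro!: sum.cong)

text \<open>A left inverse of a square matrix is also a right inverse, so orthonormality of the
  columns is the whole condition. The entrywise form suits the exchanges of sums below.\<close>

lemma unitary_mat_iff:
  "unitary_mat n V \<longleftrightarrow> V \<in> carrier_mat n n \<and>
     (\<forall>i<n. \<forall>j<n. (\<Sum>k<n. cnj (V $$ (k, i)) * V $$ (k, j)) = (if i = j then 1 else 0))"
proof -
  have "unitary_mat n V \<longleftrightarrow> V \<in> carrier_mat n n \<and> mat_adjoint V * V = 1\<^sub>m n"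
    unfolding unitary_mat_def
    using mat_mult_left_right_inverse[OF mat_adjoint_carrier, of V n V] by auto
  also have "\<dots> \<longleftrightarrow> V \<in> carrier_mat n n \<and>
      (\<forall>i<n. \<forall>j<n. (\<Sum>k<n. cnj (V $$ (k, i)) * V $$ (k, j)) = (if i = j then 1 else 0))"
  proof (rule conj_cong[OF refl])
    assume V: "V \<in> carrier_mat n n"
    have *: "mat_adjoint V * V \<in> carrier_mat n n"
      using V by (meson mat_adjoint_carrier mult_carrier_mat)
    have idx: "(mat_adjoint V * V) $$ (i, j) = (\<Sum>k<n. cnj (V $$ (k, i)) * V $$ (k, j))"
      if "i < n" "j < n" for i j
      using that V by (subst mat_mult_index_sum[OF mat_adjoint_carrier[OF V] V])
        (auto simp: mat_adjoint_index[OF V])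
    show "mat_adjoint V * V = 1\<^sub>m n \<longleftrightarrow>
        (\<forall>i<n. \<forall>j<n. (\<Sum>k<n. cnj (V $$ (k, i)) * V $$ (k, j)) = (if i = j then 1 else 0))"
    proof
      assume "mat_adjoint V * V = 1\<^sub>m n"
      then show "\<forall>i<n. \<forall>j<n. (\<Sum>k<n. cnj (V $$ (k, i)) * V $$ (k, j)) = (if i = j then 1 else 0)"
        using idx by auto
    next
      assume "\<forall>i<n. \<forall>j<n. (\<Sum>k<n. cnj (V $$ (k, i)) * V $$ (k, j)) = (if i = j then 1 else 0)"
      then show "mat_adjoint V * V = 1\<^sub>m n"
        using idx * by (intro eq_matI) auto
    qed
  qed
  finally show ?thesis .
qed

lemma unitary_mat_rows:
  assumes "unitary_mat n V" "i < n" "j < n"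
  shows "(\<Sum>k<n. V $$ (i, k) * cnj (V $$ (j, k))) = (if i = j then 1 else 0)"
proof -
  have V: "V \<in> carrier_mat n n" and *: "V * mat_adjoint V = 1\<^sub>m n"
    using assms by (auto simp: unitary_mat_def)
  have "(V * mat_adjoint V) $$ (i, j) = (\<Sum>k<n. V $$ (i, k) * cnj (V $$ (j, k)))"
    using assms by (subst mat_mult_index_sum[OF V mat_adjoint_carrier[OF V]])
      (auto simp: mat_adjoint_index[OF V])
  with * assms show ?thesis by simp
qed

text \<open>The columns of \<open>V\<close> are eigenvectors and \<open>d\<close> lists the
  eigenvalues, unordered and with multiplicity. The product form in \<open>mat_fun\<close> is
  unfolded into entries, so that later identities are rearrangements of finite sums;
  \<open>spectral_iff\<close> translates back.\<close>

definition spectral :: "nat \<Rightarrow> complex mat \<Rightarrow> complex mat \<Rightarrow> (nat \<Rightarrow> real) \<Rightarrow> bool" where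
  "spectral n A V d \<longleftrightarrow> unitary_mat n V \<and> A \<in> carrier_mat n n \<and>
     (\<forall>i<n. \<forall>j<n. A $$ (i, j) = (\<Sum>k<n. V $$ (i, k) * of_real (d k) * cnj (V $$ (j, k))))"

lemma spectral_iff:
  "spectral n A V d \<longleftrightarrow>
     unitary_mat n V \<and> A = V * mat_diag n (\<lambda>i. complex_of_real (d i)) * mat_adjoint V"
proof (cases "unitary_mat n V")
  case True
  then have V: "V \<in> carrier_mat n n" by (simp add: unitary_mat_def)
  define B where "B = V * mat_diag n (\<lambda>i. complex_of_real (d i)) * mat_adjoint V"
  have VD: "V * mat_diag n (\<lambda>i. complex_of_real (d i)) \<in> carrier_mat n n"
    using V by (rule mult_carrier_mat) simp
  have B: "B \<in> carrier_mat n n"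
    unfolding B_def by (rule mult_carrier_mat[OF VD mat_adjoint_carrier[OF V]])
  have "B $$ (i, j) = (\<Sum>k<n. V $$ (i, k) * of_real (d k) * cnj (V $$ (j, k)))"
    if "i < n" "j < n" for i j
    unfolding B_def using that
    by (subst mat_mult_index_sum[OF VD mat_adjoint_carrier[OF V]])
      (auto simp: mat_adjoint_index[OF V] mat_diag_mult_right[OF V])
  then show ?thesis
    using True B unfolding spectral_def B_def[symmetric] by (auto intro!: eq_matI)
qed (simp add: spectral_def)

definition hermitian_mat :: "nat \<Rightarrow> complex mat \<Rightarrow> bool" where
  "hermitian_mat n A \<longleftrightarrow> A \<in> carrier_mat n n \<and> (\<forall>i<n. \<forall>j<n. cnj (A $$ (i, j)) = A $$ (j, i))"

lemma cscalar_prod_sum: "dim_vec w = n \<Longrightarrow> v \<bullet>c w = (\<Sum>i<n. v $ i * cnj (w $ i))"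
  by (auto simp: scalar_prod_def atLeast0LessThan intro!: sum.cong)

lemma cscalar_prod_self: "v \<bullet>c v = of_real (\<Sum>i<dim_vec v. (cmod (v $ i))\<^sup>2)"
  by (simp add: cscalar_prod_sum complex_norm_square flip: of_real_power)

text \<open>The characteristic polynomial has degree \<open>Suc m\<close>, which is positive, and
  hence has a complex root.\<close>

lemma eigenvector_exists:
  fixes A :: "complex mat"
  assumes A: "A \<in> carrier_mat (Suc m) (Suc m)"
  shows "\<exists>v e. eigenvector A v e"
proof -
  have "degree (char_poly A) = Suc m"
    using degree_monic_char_poly[OF A] by simp
  then have "\<not> constant (poly (char_poly A))"
    by (simp add: constant_degree)
  from fundamental_theorem_of_algebra[OF this] obtain e where "poly (char_poly A) e = 0" by blast
  then have "eigenvalue A e"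
    using eigenvalue_root_char_poly[OF A] by simp
  then show ?thesis unfolding eigenvalue_def by blast
qed

text \<open>Complete \<open>v\<close> to a basis and orthogonalize: Gram-Schmidt leaves the first
  vector alone, so after normalization the first column is a multiple of \<open>v\<close>. This is
  the change of basis for the deflation in the spectral theorem.\<close>

lemma unitary_mat_with_first_col:
  fixes v :: "complex vec"
  assumes v: "v \<in> carrier_vec n" "v \<noteq> 0\<^sub>v n"
  shows "\<exists>W c. unitary_mat n W \<and> c \<noteq> 0 \<and> (\<forall>i<n. W $$ (i, 0) = c * v $ i)"
proof -
  interpret cof_vec_space n "TYPE(complex)" .
  define b where "b = basis_completion v"
  define ws where "ws = gram_schmidt n b"
  note bc = basis_completion[OF v, folded b_def]
  have n: "n \<noteq> 0" using v by auto
  from bc n obtain vs where bv: "b = v # vs" by (cases b) auto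
  from gram_schmidt_result[OF bc(2) bc(4) bc(5) ws_def]
  have ws: "set ws \<subseteq> carrier_vec n" "corthogonal ws" "length ws = n"
    using bc(6) by auto
  have hd: "hd ws = v"
    unfolding ws_def bv by (rule gram_schmidt_hd[OF v(1)])
  have wsi: "ws ! i \<in> carrier_vec n" if "i < n" for i
    using ws that by auto
  define N where "N i = (\<Sum>k<n. (cmod (ws ! i $ k))\<^sup>2)" for i
  have N: "ws ! i \<bullet>c ws ! i = of_real (N i)" if "i < n" for i
    using wsi[OF that] by (simp add: cscalar_prod_self N_def)
  have Nz: "N i > 0" if "i < n" for i
  proof -
    have "N i \<noteq> 0" using corthogonalD[OF ws(2), of i i] N[OF that] ws(3) that by auto
    moreover have "N i \<ge> 0" unfolding N_def by (intro sum_nonneg) auto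
    ultimately show ?thesis by simp
  qed
  \<comment> \<open>Gram-Schmidt returns orthogonal vectors that need not have norm one;
    \<open>N i\<close> is the squared norm of the i-th.\<close>
  define W where "W = mat n n (\<lambda>(k, i). of_real (1 / sqrt (N i)) * ws ! i $ k)"
  have "unitary_mat n W"
    unfolding unitary_mat_iff
  proof (intro conjI allI impI)
    show "W \<in> carrier_mat n n" by (simp add: W_def)
    fix i j assume ij: "i < n" "j < n"
    have "(\<Sum>k<n. cnj (W $$ (k, i)) * W $$ (k, j)) =
       of_real (1 / sqrt (N i)) * of_real (1 / sqrt (N j)) * (ws ! j \<bullet>c ws ! i)"
      using ij wsi by (simp add: W_def cscalar_prod_sum[of _ n] sum_distrib_left mult_ac)
    also have "\<dots> = (if i = j then 1 else 0)"
    proof (cases "i = j")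
      case True
      have "of_real (1 / sqrt (N j)) * of_real (1 / sqrt (N j)) * complex_of_real (N j)
          = of_real (1 / sqrt (N j) * (1 / sqrt (N j)) * N j)" by (simp only: of_real_mult)
      also have "\<dots> = 1" using Nz[of j] ij by simp
      finally show ?thesis using True ij by (simp add: N)
    next
      case False
      then show ?thesis using corthogonalD[OF ws(2), of j i] ij ws(3) by auto
    qed
    finally show "(\<Sum>k<n. cnj (W $$ (k, i)) * W $$ (k, j)) = (if i = j then 1 else 0)" .
  qed
  moreover have "ws ! 0 = v"
    using hd ws(3) n by (cases ws) auto
  then have "\<forall>i<n. W $$ (i, 0) = of_real (1 / sqrt (N 0)) * v $ i"
    using n by (simp add: W_def)
  moreover have "complex_of_real (1 / sqrt (N 0)) \<noteq> 0"
    using Nz[of 0] n by simp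
  ultimately show ?thesis by blast
qed

lemma unitary_mat_mult:
  assumes "unitary_mat n V" "unitary_mat n W"
  shows "unitary_mat n (V * W)"
proof -
  have V: "V \<in> carrier_mat n n" and W: "W \<in> carrier_mat n n"
    using assms by (auto simp: unitary_mat_def)
  show ?thesis unfolding unitary_mat_iff
  proof (intro conjI allI impI)
    show "V * W \<in> carrier_mat n n" using V W by simp
    fix i j assume ij: "i < n" "j < n"
    have "(\<Sum>k<n. cnj ((V * W) $$ (k, i)) * (V * W) $$ (k, j)) =
       (\<Sum>k<n. \<Sum>a<n. \<Sum>b<n. cnj (W $$ (a, i)) * W $$ (b, j) * (cnj (V $$ (k, a)) * V $$ (k, b)))"
      using ij by (simp add: mat_mult_index_sum[OF V W] sum_product del: index_mult_mat)
        (simp add: mult_ac)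
    also have "\<dots> = (\<Sum>a<n. \<Sum>b<n. cnj (W $$ (a, i)) * W $$ (b, j) * (\<Sum>k<n. cnj (V $$ (k, a)) * V $$ (k, b)))"
      unfolding sum_distrib_left
      by (subst sum.swap, rule sum.cong[OF refl], subst sum.swap, rule refl)
    also have "\<dots> = (\<Sum>a<n. \<Sum>b<n. cnj (W $$ (a, i)) * W $$ (b, j) * (if a = b then 1 else 0))"
      using assms(1) by (intro sum.cong refl) (simp add: unitary_mat_iff)
    also have "\<dots> = (\<Sum>a<n. cnj (W $$ (a, i)) * W $$ (a, j))"
      by (simp add: if_distrib if_distribR sum.delta cong: if_cong)
    also have "\<dots> = (if i = j then 1 else 0)"
      using assms(2) ij by (simp add: unitary_mat_iff)
    finally show "(\<Sum>k<n. cnj ((V * W) $$ (k, i)) * (V * W) $$ (k, j)) = (if i = j then 1 else 0)" .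
  qed
qed

text \<open>Since \<open>W\<close> is unitary, \<open>A\<close> is recovered as \<open>W\<close>
  times the conjugated matrix times the adjoint of \<open>W\<close>; eigenvectors are carried back
  by \<open>W\<close> and eigenvalues stay.\<close>

lemma spectral_conjugate:
  assumes W: "unitary_mat n W" and A: "A \<in> carrier_mat n n"
    and sp: "spectral n (mat_adjoint W * A * W) V d"
  shows "spectral n A (W * V) d"
proof -
  have Wc: "W \<in> carrier_mat n n" and WW: "W * mat_adjoint W = 1\<^sub>m n"
    using W by (auto simp: unitary_mat_def)
  note Wa = mat_adjoint_carrier[OF Wc]
  have V: "V \<in> carrier_mat n n" "unitary_mat n V"
    using sp by (auto simp: spectral_def unitary_mat_def)
  define A' where "A' = mat_adjoint W * A * W"
  have A': "A' \<in> carrier_mat n n" unfolding A'_def using Wa A Wc by (meson mult_carrier_mat)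
  have "W * A' * mat_adjoint W = (W * mat_adjoint W) * A * (W * mat_adjoint W)"
    unfolding A'_def using Wc Wa A
    by (simp add: assoc_mult_mat[of _ n n _ n _ n] mult_carrier_mat[of _ n n _ n])
  also have "\<dots> = A" using A by (simp add: WW)
  finally have AA: "A = W * A' * mat_adjoint W" by simp
  show ?thesis unfolding spectral_def
  proof (intro conjI allI impI unitary_mat_mult[OF W V(2)] A)
    fix i j assume ij: "i < n" "j < n"
    have WA: "W * A' \<in> carrier_mat n n" using Wc A' by simp
    have prod: "(\<Sum>a<n. X a) * c * (\<Sum>b<n. Y b) = (\<Sum>b<n. \<Sum>a<n. X a * c * Y b)"
      for X Y :: "nat \<Rightarrow> complex" and c
      by (subst sum.swap) (simp add: sum_distrib_right[of X _ c] sum_product)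
    have "A $$ (i, j) = (\<Sum>b<n. (\<Sum>a<n. W $$ (i, a) * A' $$ (a, b)) * cnj (W $$ (j, b)))"
      using ij by (subst AA) (simp add: mat_mult_index_sum[OF WA Wa] mat_mult_index_sum[OF Wc A']
        mat_adjoint_index[OF Wc] del: index_mult_mat)
    also have "\<dots> = (\<Sum>b<n. \<Sum>a<n. \<Sum>k<n. W $$ (i, a) * V $$ (a, k) * of_real (d k) * cnj (W $$ (j, b) * V $$ (b, k)))"
      using sp unfolding spectral_def A'_def[symmetric]
      by (auto simp: sum_distrib_left sum_distrib_right mult_ac intro!: sum.cong)
    also have "\<dots> = (\<Sum>k<n. \<Sum>b<n. \<Sum>a<n. W $$ (i, a) * V $$ (a, k) * of_real (d k) * cnj (W $$ (j, b) * V $$ (b, k)))"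
      by (subst (2) sum.swap, subst sum.swap, rule refl)
    also have "\<dots> = (\<Sum>k<n. (W * V) $$ (i, k) * of_real (d k) * cnj ((W * V) $$ (j, k)))"
    proof (rule sum.cong[OF refl])
      fix k assume "k \<in> {..<n}"
      then show "(\<Sum>b<n. \<Sum>a<n. W $$ (i, a) * V $$ (a, k) * of_real (d k) * cnj (W $$ (j, b) * V $$ (b, k)))
          = (W * V) $$ (i, k) * of_real (d k) * cnj ((W * V) $$ (j, k))"
        using ij by (simp add: mat_mult_index_sum[OF Wc V(1)] prod del: index_mult_mat)
    qed
    finally show "A $$ (i, j) = (\<Sum>k<n. (W * V) $$ (i, k) * of_real (d k) * cnj ((W * V) $$ (j, k)))" .
  qed
qed

text \<open>Deflation by induction on the dimension: in an orthonormal basis that starts with an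
  eigenvector, the first column of the matrix is \<open>e\<close> times the first unit vector, and
  hermiticity clears the first row as well. What remains is a Hermitian matrix of dimension
  \<open>m\<close>.\<close>

theorem hermitian_mat_spectral:
  assumes "hermitian_mat n A"
  shows "\<exists>V d. spectral n A V d"
  using assms
proof (induction n arbitrary: A)
  case 0
  then show ?case
    by (auto simp: spectral_def unitary_mat_iff hermitian_mat_def)
next
  case (Suc m)
  have A: "A \<in> carrier_mat (Suc m) (Suc m)"
    and herm: "\<And>i j. i < Suc m \<Longrightarrow> j < Suc m \<Longrightarrow> cnj (A $$ (i, j)) = A $$ (j, i)"
    using Suc.prems by (simp_all add: hermitian_mat_def)
  define n where "n = Suc m"
  note A = A[folded n_def] and herm = herm[folded n_def]
  from eigenvector_exists[of A m] A obtain v e where "eigenvector A v e" by (auto simp: n_def)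
  then have v: "v \<in> carrier_vec n" "v \<noteq> 0\<^sub>v n" and ev: "A *\<^sub>v v = e \<cdot>\<^sub>v v"
    using A by (auto simp: eigenvector_def)
  have evi: "(\<Sum>b<n. A $$ (a, b) * v $ b) = e * v $ a" if "a < n" for a
  proof -
    have "(A *\<^sub>v v) $ a = (\<Sum>b<n. A $$ (a, b) * v $ b)"
      using A v that by (auto simp: scalar_prod_def atLeast0LessThan intro!: sum.cong)
    then show ?thesis using ev v that by simp
  qed
  from unitary_mat_with_first_col[OF v] obtain W c
    where W: "unitary_mat n W" and c: "c \<noteq> 0" "\<And>i. i < n \<Longrightarrow> W $$ (i, 0) = c * v $ i" by blast
  have Wc: "W \<in> carrier_mat n n" using W by (simp add: unitary_mat_def)
  note Wa = mat_adjoint_carrier[OF Wc]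
  define A' where "A' = mat_adjoint W * A * W"
  have A': "A' \<in> carrier_mat n n" unfolding A'_def using Wa A Wc by (meson mult_carrier_mat)
  have A'_idx: "A' $$ (i, j) = (\<Sum>b<n. \<Sum>a<n. cnj (W $$ (a, i)) * A $$ (a, b) * W $$ (b, j))"
    if "i < n" "j < n" for i j
  proof -
    have WA: "mat_adjoint W * A \<in> carrier_mat n n" using Wa A by simp
    show ?thesis using that unfolding A'_def
      by (simp add: mat_mult_index_sum[OF WA Wc] mat_mult_index_sum[OF Wa A]
        mat_adjoint_index[OF Wc] sum_distrib_right del: index_mult_mat)
  qed
  have herm': "cnj (A' $$ (j, i)) = A' $$ (i, j)" if "i < n" "j < n" for i j
  proof -
    have "cnj (A' $$ (j, i)) = (\<Sum>b<n. \<Sum>a<n. W $$ (a, j) * cnj (A $$ (a, b)) * cnj (W $$ (b, i)))"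
      using that by (simp add: A'_idx)
    also have "\<dots> = (\<Sum>b<n. \<Sum>a<n. W $$ (a, j) * A $$ (b, a) * cnj (W $$ (b, i)))"
      by (intro sum.cong refl) (simp add: herm)
    also have "\<dots> = A' $$ (i, j)"
      using that by (subst sum.swap) (simp add: A'_idx mult_ac)
    finally show ?thesis .
  qed
  have col0: "A' $$ (i, 0) = (if i = 0 then e else 0)" if "i < n" for i
  proof -
    have "A' $$ (i, 0) = (\<Sum>a<n. \<Sum>b<n. cnj (W $$ (a, i)) * A $$ (a, b) * W $$ (b, 0))"
      using that by (subst sum.swap) (simp add: A'_idx n_def)
    also have "\<dots> = (\<Sum>a<n. cnj (W $$ (a, i)) * c * (\<Sum>b<n. A $$ (a, b) * v $ b))"
      by (simp add: c sum_distrib_left mult_ac)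
    also have "\<dots> = e * (\<Sum>a<n. cnj (W $$ (a, i)) * W $$ (a, 0))"
      by (simp add: evi c) (simp add: sum_distrib_left mult_ac)
    also have "\<dots> = (if i = 0 then e else 0)"
      using W that by (simp add: unitary_mat_iff n_def)
    finally show ?thesis .
  qed
  have row0: "A' $$ (0, i) = (if i = 0 then e else 0)" if "i < n" for i
    using herm'[of i 0] col0[OF that] col0[of 0] herm'[of 0 0] that by (auto simp: n_def)
  \<comment> \<open>The eigenvalue is a diagonal entry of a Hermitian matrix, hence real.\<close>
  have e: "e = of_real (Re e)"
    using herm'[of 0 0] col0[of 0] by (simp add: n_def complex_eq_iff)
  define A3 where "A3 = mat m m (\<lambda>(i, j). A' $$ (Suc i, Suc j))"
  have "hermitian_mat m A3"
    unfolding hermitian_mat_def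
    using herm' by (simp add: A3_def n_def)
  from Suc.IH[OF this] obtain P d where sp: "spectral m A3 P d" by blast
  then have P: "\<And>i j. i < m \<Longrightarrow> j < m \<Longrightarrow> (\<Sum>k<m. cnj (P $$ (k, i)) * P $$ (k, j)) = (if i = j then 1 else 0)"
    by (auto simp: spectral_def unitary_mat_iff)
  \<comment> \<open>\<open>B\<close> is the direct sum of the scalar 1 and \<open>P\<close>: the
    eigenvector stays in front and the eigenbasis of the smaller block follows.\<close>
  define B where "B = mat n n (\<lambda>(i, j). case (i, j) of (0, 0) \<Rightarrow> 1 | (Suc i, Suc j) \<Rightarrow> P $$ (i, j) | _ \<Rightarrow> 0)"
  define d' where "d' = (\<lambda>i. case i of 0 \<Rightarrow> Re e | Suc i \<Rightarrow> d i)"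
  have B: "B $$ (0, 0) = 1" "\<And>i. i < m \<Longrightarrow> B $$ (0, Suc i) = 0" "\<And>i. i < m \<Longrightarrow> B $$ (Suc i, 0) = 0"
    "\<And>i j. i < m \<Longrightarrow> j < m \<Longrightarrow> B $$ (Suc i, Suc j) = P $$ (i, j)"
    by (auto simp: B_def n_def)
  have "spectral n A' B d'"
    unfolding spectral_def unitary_mat_iff
  proof (intro conjI allI impI A')
    show "B \<in> carrier_mat n n" by (simp add: B_def)
    fix i j assume ij: "i < n" "j < n"
    show "(\<Sum>k<n. cnj (B $$ (k, i)) * B $$ (k, j)) = (if i = j then 1 else 0)"
      using ij unfolding n_def sum.lessThan_Suc_shift
      by (cases i; cases j) (auto simp: B P)
    have A3: "A' $$ (Suc i, Suc j) = (\<Sum>k<m. P $$ (i, k) * of_real (d k) * cnj (P $$ (j, k)))"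
      if "i < m" "j < m" for i j
      using sp that by (auto simp: spectral_def A3_def)
    show "A' $$ (i, j) = (\<Sum>k<n. B $$ (i, k) * of_real (d' k) * cnj (B $$ (j, k)))"
      using ij e unfolding n_def sum.lessThan_Suc_shift
      by (cases i; cases j) (auto simp: B A3 d'_def row0 col0 n_def)
  qed
  from spectral_conjugate[OF W A this[unfolded A'_def]] show ?case
    unfolding n_def by blast
qed

section \<open>Supports of positive semidefinite matrices\<close>

lemma quad_form_sum:
  assumes "A \<in> carrier_mat n n" "v \<in> carrier_vec n"
  shows "(A *\<^sub>v v) \<bullet>c v = (\<Sum>i<n. \<Sum>j<n. A $$ (i, j) * v $ j * cnj (v $ i))"
  using assms
  by (auto simp: cscalar_prod_sum[of _ n] scalar_prod_def atLeast0LessThan sum_distrib_right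
      intro!: sum.cong)

text \<open>Polarization: the form is real at all vectors, so its mixed terms are real too.
  Coefficient 1 makes the imaginary parts of two opposite entries cancel, and the imaginary unit as
  coefficient makes their real parts agree.\<close>

lemma psd_hermitian:
  assumes "psd n A"
  shows "hermitian_mat n A"
proof -
  have A: "A \<in> carrier_mat n n" and pos: "\<And>v. v \<in> carrier_vec n \<Longrightarrow> (A *\<^sub>v v) \<bullet>c v \<ge> 0"
    using assms by (auto simp: psd_def)
  have real: "Im ((A *\<^sub>v v) \<bullet>c v) = 0" if "v \<in> carrier_vec n" for v
    using pos[OF that] by (simp add: less_eq_complex_def)
  have diag: "Im (A $$ (i, i)) = 0" if i: "i < n" for i
  proof -
    have "(A *\<^sub>v unit_vec n i) \<bullet>c unit_vec n i = A $$ (i, i)"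
    proof -
      have "(\<Sum>l<n. A $$ (k, l) * unit_vec n i $ l * cnj (unit_vec n i $ k)) = (if k = i then A $$ (i, i) else 0)"
        if "k < n" for k
        using i that by (simp add: unit_vec_def if_distrib[of "\<lambda>x. _ * x"] sum.delta cong: if_cong)
      then show ?thesis using i by (simp add: quad_form_sum[OF A] sum.delta)
    qed
    then show ?thesis using real[of "unit_vec n i"] by simp
  qed
  have off: "Im (A $$ (i, j) * cnj c + A $$ (j, i) * c) = 0" if ij: "i < n" "j < n" "i \<noteq> j" for i j c
  proof -
    \<comment> \<open>Supported on two positions, this vector isolates the entries
      \<open>(i, j)\<close> and \<open>(j, i)\<close> up to the diagonal ones, which are already
      known to be real.\<close>
    define v where "v = vec n (\<lambda>k. if k = i then c else if k = j then 1 else 0)"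
    have v: "v \<in> carrier_vec n" "v $ i = c" "v $ j = 1" "\<And>k. k < n \<Longrightarrow> k \<noteq> i \<Longrightarrow> k \<noteq> j \<Longrightarrow> v $ k = 0"
      using ij by (auto simp: v_def)
    have two: "(\<Sum>k<n. f k) = f i + f j" if "\<And>k. k < n \<Longrightarrow> k \<noteq> i \<Longrightarrow> k \<noteq> j \<Longrightarrow> f k = 0"
      for f :: "nat \<Rightarrow> complex"
    proof -
      have "(\<Sum>k<n. f k) = (\<Sum>k\<in>{i, j}. f k)"
        using ij that by (intro sum.mono_neutral_right) auto
      then show ?thesis using ij by simp
    qed
    have "(A *\<^sub>v v) \<bullet>c v = (\<Sum>k<n. A $$ (k, i) * c * cnj (v $ k) + A $$ (k, j) * cnj (v $ k))"
      unfolding quad_form_sum[OF A v(1)] by (intro sum.cong refl) (simp add: two v)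
    also have "\<dots> = A $$ (i, i) * (c * cnj c) + A $$ (j, j) + (A $$ (i, j) * cnj c + A $$ (j, i) * c)"
      by (subst two) (simp_all add: v algebra_simps)
    finally show ?thesis
      using real[OF v(1)] diag[OF ij(1)] diag[OF ij(2)] by (simp add: complex_mult_cnj)
  qed
  show ?thesis unfolding hermitian_mat_def
  proof (intro conjI allI impI A)
    fix i j assume ij: "i < n" "j < n"
    show "cnj (A $$ (i, j)) = A $$ (j, i)"
    proof (cases "i = j")
      case True
      then show ?thesis using diag[OF ij(1)] by (simp add: complex_eq_iff)
    next
      case False
      then show ?thesis using off[OF ij False, of 1] off[OF ij False, of \<i>]
        by (simp add: complex_eq_iff)
    qed
  qed
qed

section \<open>Coordinates in eigenbases and overlaps of two bases\<close>

text \<open>For unitary \<open>V\<close> this is the k-th coordinate of \<open>v\<close> in the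
  basis of the columns of \<open>V\<close>.\<close>

definition coef :: "nat \<Rightarrow> complex mat \<Rightarrow> complex vec \<Rightarrow> nat \<Rightarrow> complex" where
  "coef n V v k = (\<Sum>a<n. cnj (V $$ (a, k)) * v $ a)"

text \<open>Entry of the transition matrix between two bases: the inner product of the i-th column
  of \<open>V\<close> with the j-th column of \<open>W\<close>.\<close>

definition overlap :: "nat \<Rightarrow> complex mat \<Rightarrow> complex mat \<Rightarrow> nat \<Rightarrow> nat \<Rightarrow> complex" where
  "overlap n V W i j = (\<Sum>a<n. cnj (V $$ (a, i)) * W $$ (a, j))"

lemma coef_col: "W \<in> carrier_mat n n \<Longrightarrow> j < n \<Longrightarrow> coef n V (col W j) i = overlap n V W i j"
  by (simp add: coef_def overlap_def)

lemma overlap_cnj: "overlap n V W i j = cnj (overlap n W V j i)"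
  by (simp add: overlap_def mult.commute)

lemma overlap_self: "unitary_mat n V \<Longrightarrow> i < n \<Longrightarrow> j < n \<Longrightarrow> overlap n V V i j = (if i = j then 1 else 0)"
  by (simp add: overlap_def unitary_mat_iff)

text \<open>Insert the resolution of the identity by the columns of \<open>W\<close>.\<close>

lemma coef_expand:
  assumes W: "unitary_mat n W" and "i < n"
  shows "coef n V v i = (\<Sum>j<n. overlap n V W i j * coef n W v j)"
proof -
  have "(\<Sum>j<n. overlap n V W i j * coef n W v j) =
      (\<Sum>j<n. \<Sum>a<n. \<Sum>b<n. cnj (V $$ (a, i)) * v $ b * (W $$ (a, j) * cnj (W $$ (b, j))))"
    by (simp add: overlap_def coef_def sum_product) (simp add: mult_ac)
  also have "\<dots> = (\<Sum>a<n. \<Sum>b<n. cnj (V $$ (a, i)) * v $ b * (\<Sum>j<n. W $$ (a, j) * cnj (W $$ (b, j))))"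
    unfolding sum_distrib_left
    by (subst sum.swap, rule sum.cong[OF refl], subst sum.swap, rule refl)
  also have "\<dots> = (\<Sum>a<n. \<Sum>b<n. cnj (V $$ (a, i)) * v $ b * (if a = b then 1 else 0))"
    by (intro sum.cong refl) (simp add: unitary_mat_rows[OF W])
  also have "\<dots> = coef n V v i"
    by (simp add: coef_def if_distrib[of "\<lambda>x. _ * x"] sum.delta cong: if_cong)
  finally show ?thesis ..
qed

text \<open>Parseval for the i-th column of \<open>V\<close> in the basis \<open>W\<close>. Together
  with the column sums it makes the squared moduli a doubly stochastic matrix, which allows a sum
  over one spectrum to be spread over pairs of eigenvectors.\<close>

lemma overlap_row_sum:
  assumes V: "unitary_mat n V" and W: "unitary_mat n W" and i: "i < n"
  shows "(\<Sum>j<n. (cmod (overlap n V W i j))\<^sup>2) = 1"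
proof -
  have Vc: "V \<in> carrier_mat n n" using V by (simp add: unitary_mat_def)
  have "(\<Sum>j<n. complex_of_real ((cmod (overlap n V W i j))\<^sup>2)) =
     (\<Sum>j<n. overlap n V W i j * coef n W (col V i) j)"
    unfolding coef_col[OF Vc i] overlap_cnj[of n W V] complex_norm_square ..
  also have "\<dots> = overlap n V V i i"
    using coef_expand[OF W i, of V "col V i"] coef_col[OF Vc i] by simp
  also have "\<dots> = 1" using V i by (simp add: overlap_self)
  finally show ?thesis
    by (metis of_real_eq_1_iff of_real_sum)
qed

lemma overlap_col_sum:
  assumes V: "unitary_mat n V" and W: "unitary_mat n W" and j: "j < n"
  shows "(\<Sum>i<n. (cmod (overlap n V W i j))\<^sup>2) = 1"
  using overlap_row_sum[OF W V j] by (simp add: overlap_cnj[of n W V j])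

context
  fixes n A V d
  assumes sp: "spectral n A V d"
begin

lemma spectral_carrier: "A \<in> carrier_mat n n" "V \<in> carrier_mat n n" "unitary_mat n V"
  using sp by (auto simp: spectral_def unitary_mat_def)

lemma spectral_mult_vec:
  assumes "v \<in> carrier_vec n" "i < n"
  shows "(A *\<^sub>v v) $ i = (\<Sum>k<n. V $$ (i, k) * of_real (d k) * coef n V v k)"
proof -
  have "(A *\<^sub>v v) $ i = (\<Sum>j<n. A $$ (i, j) * v $ j)"
    using assms spectral_carrier by (auto simp: scalar_prod_def atLeast0LessThan intro!: sum.cong)
  also have "\<dots> = (\<Sum>j<n. \<Sum>k<n. V $$ (i, k) * of_real (d k) * (cnj (V $$ (j, k)) * v $ j))"
    using sp assms by (intro sum.cong refl) (simp add: spectral_def sum_distrib_left sum_distrib_right mult_ac)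
  also have "\<dots> = (\<Sum>k<n. V $$ (i, k) * of_real (d k) * coef n V v k)"
    by (subst sum.swap) (simp add: coef_def sum_distrib_left)
  finally show ?thesis .
qed

lemma spectral_quad_form:
  assumes v: "v \<in> carrier_vec n"
  shows "(A *\<^sub>v v) \<bullet>c v = of_real (\<Sum>k<n. d k * (cmod (coef n V v k))\<^sup>2)"
proof -
  have "(A *\<^sub>v v) \<bullet>c v = (\<Sum>i<n. (A *\<^sub>v v) $ i * cnj (v $ i))"
    using v by (simp add: cscalar_prod_sum)
  also have "\<dots> = (\<Sum>i<n. \<Sum>k<n. of_real (d k) * coef n V v k * (V $$ (i, k) * cnj (v $ i)))"
    by (intro sum.cong refl) (simp add: spectral_mult_vec v sum_distrib_left sum_distrib_right mult_ac del: index_mult_mat_vec)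
  also have "\<dots> = (\<Sum>k<n. of_real (d k) * coef n V v k * (\<Sum>i<n. V $$ (i, k) * cnj (v $ i)))"
    by (subst sum.swap) (simp add: sum_distrib_left)
  also have "\<dots> = (\<Sum>k<n. of_real (d k) * (coef n V v k * cnj (coef n V v k)))"
    by (simp add: coef_def mult.assoc)
  finally show ?thesis
    by (simp flip: complex_norm_square)
qed

lemma spectral_psd_iff: "psd n A \<longleftrightarrow> (\<forall>k<n. d k \<ge> 0)"
proof
  assume *: "psd n A"
  show "\<forall>k<n. d k \<ge> 0"
  proof (intro allI impI)
    fix k assume k: "k < n"
    \<comment> \<open>Evaluating the form at an eigenvector reads off its eigenvalue.\<close>
    have "(A *\<^sub>v col V k) \<bullet>c col V k = of_real (\<Sum>l<n. d l * (cmod (if l = k then 1 else 0))\<^sup>2)"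
      using k spectral_carrier
      by (subst spectral_quad_form) (auto simp: coef_col overlap_self intro!: sum.cong)
    also have "\<dots> = of_real (d k)"
      using k by (simp add: if_distrib[of cmod] if_distrib[of "\<lambda>x. x\<^sup>2"]
        if_distrib[of "\<lambda>x. _ * x"] sum.delta cong: if_cong)
    finally have eq: "(A *\<^sub>v col V k) \<bullet>c col V k = of_real (d k)" .
    have "(A *\<^sub>v col V k) \<bullet>c col V k \<ge> 0"
      using * k spectral_carrier by (simp add: psd_def)
    then show "d k \<ge> 0" unfolding eq by (simp add: less_eq_complex_def)
  qed
next
  assume "\<forall>k<n. d k \<ge> 0"
  then show "psd n A"
    using spectral_carrier
    by (auto simp: psd_def spectral_quad_form less_eq_complex_def intro!: sum_nonneg)
qed

lemma spectral_kernel_iff: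
  assumes w: "w \<in> carrier_vec n"
  shows "w \<in> mat_kernel A \<longleftrightarrow> (\<forall>k<n. d k = 0 \<or> coef n V w k = 0)"
proof
  assume "w \<in> mat_kernel A"
  then have Aw: "A *\<^sub>v w = 0\<^sub>v n"
    using spectral_carrier by (auto simp: mat_kernel_def)
  show "\<forall>k<n. d k = 0 \<or> coef n V w k = 0"
  proof (intro allI impI)
    fix l assume l: "l < n"
    \<comment> \<open>Pairing the zero vector \<open>A w\<close> with the l-th eigenvector isolates
      the l-th term.\<close>
    have "0 = (\<Sum>i<n. cnj (V $$ (i, l)) * (A *\<^sub>v w) $ i)"
      unfolding Aw by simp
    also have "\<dots> = (\<Sum>i<n. \<Sum>k<n. of_real (d k) * coef n V w k * (cnj (V $$ (i, l)) * V $$ (i, k)))"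
      by (intro sum.cong refl) (simp add: spectral_mult_vec w sum_distrib_left mult_ac del: index_mult_mat_vec)
    also have "\<dots> = (\<Sum>k<n. of_real (d k) * coef n V w k * overlap n V V l k)"
      by (subst sum.swap) (simp add: sum_distrib_left overlap_def)
    also have "\<dots> = (\<Sum>k<n. of_real (d k) * coef n V w k * (if l = k then 1 else 0))"
      using l spectral_carrier by (intro sum.cong refl) (simp add: overlap_self)
    also have "\<dots> = of_real (d l) * coef n V w l"
      using l by (simp add: if_distrib[of "\<lambda>x. _ * x"] sum.delta cong: if_cong)
    finally show "d l = 0 \<or> coef n V w l = 0" by auto
  qed
next
  assume *: "\<forall>k<n. d k = 0 \<or> coef n V w k = 0"
  have "A *\<^sub>v w = 0\<^sub>v n"
  proof (rule eq_vecI)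
    fix i assume "i < dim_vec (0\<^sub>v n :: complex vec)"
    then have i: "i < n" by simp
    have "(A *\<^sub>v w) $ i = 0"
      unfolding spectral_mult_vec[OF w i] using * by (intro sum.neutral) auto
    then show "(A *\<^sub>v w) $ i = 0\<^sub>v n $ i" using i by simp
  qed (use spectral_carrier in simp)
  then show "w \<in> mat_kernel A"
    using w spectral_carrier by (auto simp: mat_kernel_def)
qed

lemma spectral_trace: "mat_trace A = of_real (\<Sum>k<n. d k)"
proof -
  have "mat_trace A = (\<Sum>i<n. \<Sum>k<n. of_real (d k) * (cnj (V $$ (i, k)) * V $$ (i, k)))"
    using sp spectral_carrier by (auto simp: mat_trace_def spectral_def mult_ac intro!: sum.cong)
  also have "\<dots> = (\<Sum>k<n. of_real (d k) * overlap n V V k k)"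
    by (subst sum.swap) (simp add: overlap_def sum_distrib_left)
  also have "\<dots> = (\<Sum>k<n. of_real (d k))"
    using spectral_carrier by (intro sum.cong refl) (simp add: overlap_self)
  finally show ?thesis by simp
qed

text \<open>Here the definite description in \<open>mat_fun\<close> is resolved: functions of
  \<open>A\<close> share its eigenbasis, so the logarithm needs no diagonalization of its
  own.\<close>

lemma spectral_mat_fun: "spectral n (mat_fun f A) V (\<lambda>i. f (d i))"
  using sp mat_fun_eq[of n V A d f] unfolding spectral_iff by simp

end

lemma psd_spectral:
  assumes "psd n A"
  obtains V d where "spectral n A V d" "\<And>k. k < n \<Longrightarrow> d k \<ge> 0"
  using hermitian_mat_spectral[OF psd_hermitian[OF assms]] spectral_psd_iff assms by blast

text \<open>The source of the overlap weights in the entropy formulas below: expand both matrices in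
  their eigenbases and sum over the entries.\<close>

lemma spectral_trace_mult:
  assumes A: "spectral n A V d" and B: "spectral n B W s"
  shows "mat_trace (A * B) = of_real (\<Sum>i<n. \<Sum>j<n. (cmod (overlap n V W i j))\<^sup>2 * (d i * s j))"
proof -
  note Ac = spectral_carrier[OF A] and Bc = spectral_carrier[OF B]
  have "mat_trace (A * B) = (\<Sum>a<n. \<Sum>b<n. A $$ (a, b) * B $$ (b, a))"
    using Ac Bc by (auto simp: mat_trace_def mat_mult_index_sum[OF Ac(1) Bc(1)] simp del: index_mult_mat(1) intro!: sum.cong)
  also have "\<dots> = (\<Sum>a<n. \<Sum>b<n. \<Sum>i<n. \<Sum>j<n. of_real (d i * s j) *
      ((cnj (V $$ (b, i)) * W $$ (b, j)) * cnj (cnj (V $$ (a, i)) * W $$ (a, j))))"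
    using A B by (intro sum.cong refl) (simp add: spectral_def sum_product mult_ac)
  also have "\<dots> = (\<Sum>i<n. \<Sum>j<n. \<Sum>a<n. \<Sum>b<n. of_real (d i * s j) *
      ((cnj (V $$ (b, i)) * W $$ (b, j)) * cnj (cnj (V $$ (a, i)) * W $$ (a, j))))"
    (is "(\<Sum>a<n. \<Sum>b<n. \<Sum>i<n. \<Sum>j<n. ?f a b i j) = _")
  proof -
    have "(\<Sum>a<n. \<Sum>b<n. \<Sum>i<n. \<Sum>j<n. ?f a b i j) = (\<Sum>a<n. \<Sum>i<n. \<Sum>j<n. \<Sum>b<n. ?f a b i j)"
      by (rule sum.cong[OF refl], subst sum.swap, rule sum.cong[OF refl], rule sum.swap)
    also have "\<dots> = (\<Sum>i<n. \<Sum>j<n. \<Sum>a<n. \<Sum>b<n. ?f a b i j)"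
      by (subst sum.swap, rule sum.cong[OF refl], rule sum.swap)
    finally show ?thesis .
  qed
  also have "\<dots> = (\<Sum>i<n. \<Sum>j<n. of_real (d i * s j) * (overlap n V W i j * cnj (overlap n V W i j)))"
  proof (intro sum.cong refl)
    fix i j
    show "(\<Sum>a<n. \<Sum>b<n. ?f a b i j) = of_real (d i * s j) * (overlap n V W i j * cnj (overlap n V W i j))"
      unfolding overlap_def cnj_sum unfolding sum_product unfolding sum_distrib_left by (rule sum.swap)
  qed
  finally show ?thesis
    by (simp add: mult_ac flip: complex_norm_square)
qed

text \<open>In eigenbases \<open>x\<^sub>i\<close>, \<open>y\<^sub>j\<close> of two Hermitian matrices with eigenvalues \<open>d\<^sub>i\<close>, \<open>s\<^sub>j\<close>, the inclusion
  of supports says that \<open>x\<^sub>i \<bottom> y\<^sub>j\<close> whenever \<open>d\<^sub>i \<noteq> 0\<close> and \<open>s\<^sub>j = 0\<close>.\<close>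

lemma supp_subset_iff_overlap:
  assumes A: "spectral n A V d" and B: "spectral n B W s"
  shows "supp A \<subseteq> supp B \<longleftrightarrow>
    (\<forall>i<n. \<forall>j<n. d i \<noteq> 0 \<longrightarrow> s j = 0 \<longrightarrow> overlap n V W i j = 0)"
proof
  note Ac = spectral_carrier[OF A] and Bc = spectral_carrier[OF B]
  have ip: "col V i \<bullet>c w = cnj (coef n V w i)" if "i < n" "w \<in> carrier_vec n" for i w
    using that Ac by (simp add: cscalar_prod_sum coef_def)
  have ker: "mat_kernel A \<subseteq> carrier_vec n" "mat_kernel B \<subseteq> carrier_vec n"
    using Ac Bc by (auto simp: mat_kernel_def)
  {
    assume sub: "supp A \<subseteq> supp B"
    show "\<forall>i<n. \<forall>j<n. d i \<noteq> 0 \<longrightarrow> s j = 0 \<longrightarrow> overlap n V W i j = 0"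
    proof (intro allI impI)
      fix i j assume ij: "i < n" "j < n" "d i \<noteq> 0" "s j = 0"
      \<comment> \<open>\<open>col V i\<close> is orthogonal to the kernel of \<open>A\<close>
        because its eigenvalue is nonzero, while \<open>col W j\<close> lies in the kernel of
        \<open>B\<close>.\<close>
      have "col V i \<in> supp A"
        unfolding supp_def
      proof (intro CollectI conjI ballI)
        fix w assume "w \<in> mat_kernel A"
        moreover from this have "w \<in> carrier_vec n" using ker(1) by blast
        ultimately show "col V i \<bullet>c w = 0"
          using spectral_kernel_iff[OF A, of w] ij ip[of i w] by auto
      qed (use ij Ac in simp)
      then have "col V i \<in> supp B" using sub by blast
      moreover have "col W j \<in> mat_kernel B"
        using ij Bc by (subst spectral_kernel_iff[OF B]) (auto simp: coef_col overlap_self)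
      ultimately have "col V i \<bullet>c col W j = 0" by (auto simp: supp_def)
      then show "overlap n V W i j = 0"
        using ij Bc by (simp add: ip coef_col)
    qed
  next
    assume ov: "\<forall>i<n. \<forall>j<n. d i \<noteq> 0 \<longrightarrow> s j = 0 \<longrightarrow> overlap n V W i j = 0"
    \<comment> \<open>Taking orthogonal complements reverses inclusions, so it suffices to compare
      the kernels.\<close>
    have "mat_kernel B \<subseteq> mat_kernel A"
    proof
      fix w assume w: "w \<in> mat_kernel B"
      with ker have wc: "w \<in> carrier_vec n" by auto
      have "d i = 0 \<or> coef n V w i = 0" if i: "i < n" for i
      proof (cases "d i = 0")
        case False
        then have "coef n V w i = 0"
          unfolding coef_expand[OF Bc(3) i] using w[unfolded spectral_kernel_iff[OF B wc]] ov i
          by (intro sum.neutral) auto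
        then show ?thesis ..
      qed simp
      then show "w \<in> mat_kernel A"
        using spectral_kernel_iff[OF A wc] by blast
    qed
    then show "supp A \<subseteq> supp B"
      using Ac Bc by (auto simp: supp_def)
  }
qed

section \<open>Support inclusion as domination in the Loewner order\<close>

text \<open>Lagrange's identity: twice the gap between the two sides is the sum of the squares of
  all \<open>a i * b j - a j * b i\<close>.\<close>

lemma cauchy_schwarz_sum:
  fixes a b :: "nat \<Rightarrow> real"
  shows "(\<Sum>i\<in>S. a i * b i)\<^sup>2 \<le> (\<Sum>i\<in>S. (a i)\<^sup>2) * (\<Sum>i\<in>S. (b i)\<^sup>2)"
proof -
  have "0 \<le> (\<Sum>i\<in>S. \<Sum>j\<in>S. (a i * b j - a j * b i)\<^sup>2)"
    by (intro sum_nonneg) auto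
  also have "\<dots> = (\<Sum>i\<in>S. \<Sum>j\<in>S. (a i)\<^sup>2 * (b j)\<^sup>2) + (\<Sum>i\<in>S. \<Sum>j\<in>S. (b i)\<^sup>2 * (a j)\<^sup>2)
      - 2 * (\<Sum>i\<in>S. \<Sum>j\<in>S. (a i * b i) * (a j * b j))"
    by (simp add: sum.distrib sum_subtractf sum_distrib_left power2_eq_square algebra_simps)
  also have "\<dots> = 2 * ((\<Sum>i\<in>S. (a i)\<^sup>2) * (\<Sum>i\<in>S. (b i)\<^sup>2)) - 2 * (\<Sum>i\<in>S. a i * b i)\<^sup>2"
    unfolding sum_product[symmetric] by (simp add: power2_eq_square[of "\<Sum>i\<in>S. a i * b i"] mult.commute)
  finally show ?thesis by simp
qed

text \<open>Serves as the spectral gap above zero of a positive semidefinite matrix. The start value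
  1 is arbitrary; it remains if no \<open>s j\<close> is positive.\<close>

lemma pos_lower_bound:
  fixes s :: "nat \<Rightarrow> real"
  shows "\<exists>c>0. \<forall>j<n. s j > 0 \<longrightarrow> c \<le> s j"
proof (induction n)
  case 0
  show ?case by (auto intro: exI[of _ 1])
next
  case (Suc n)
  then obtain c where "c > 0" "\<forall>j<n. s j > 0 \<longrightarrow> c \<le> s j" by blast
  then show ?case
    by (intro exI[of _ "if s n > 0 then min c (s n) else c"]) (auto simp: less_Suc_eq)
qed

lemma quad_form_minus:
  fixes A B :: "complex mat"
  assumes "A \<in> carrier_mat n n" "B \<in> carrier_mat n n" "v \<in> carrier_vec n"
  shows "((B - c \<cdot>\<^sub>m A) *\<^sub>v v) \<bullet>c v = (B *\<^sub>v v) \<bullet>c v - c * ((A *\<^sub>v v) \<bullet>c v)"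
proof -
  have "B - c \<cdot>\<^sub>m A \<in> carrier_mat n n"
    using assms by (intro minus_carrier_mat smult_carrier_mat)
  from quad_form_sum[OF this assms(3)] show ?thesis
    unfolding quad_form_sum[OF assms(1,3)] quad_form_sum[OF assms(2,3)] using assms
    by (simp add: sum_subtractf sum_distrib_left algebra_simps)
qed

text \<open>A positive multiple of \<open>A\<close> lies below \<open>B\<close> in the Loewner
  order. Unlike inclusion of supports, this form is visibly preserved by positive linear maps, and
  its constant is a weight with which \<open>A\<close> can be split off from
  \<open>B\<close>.\<close>

definition dominated :: "nat \<Rightarrow> complex mat \<Rightarrow> complex mat \<Rightarrow> bool" where
  "dominated n A B \<longleftrightarrow> (\<exists>c>0. psd n (B - complex_of_real c \<cdot>\<^sub>m A))"

text \<open>If c \<open>A\<close> lies below \<open>B\<close>, the form of \<open>A\<close> vanishes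
  on null vectors of \<open>B\<close>, and with it every term
  \<open>d k * (cmod (coef n V v k))\<^sup>2\<close>. Conversely, an eigenvector of \<open>A\<close>
  with nonzero eigenvalue sees only the part of \<open>v\<close> in the support of \<open>B\<close>,
  where \<open>B\<close> is at least its smallest positive eigenvalue.\<close>

lemma dominated_iff_supp:
  assumes "psd n A" "psd n B"
  shows "dominated n A B \<longleftrightarrow> supp A \<subseteq> supp B"
proof -
  from psd_spectral[OF assms(1)] obtain V d where A: "spectral n A V d" and d: "\<And>k. k < n \<Longrightarrow> d k \<ge> 0" by blast
  from psd_spectral[OF assms(2)] obtain W s where B: "spectral n B W s" and s: "\<And>k. k < n \<Longrightarrow> s k \<ge> 0" by blast
  note Ac = spectral_carrier[OF A] and Bc = spectral_carrier[OF B]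
  show ?thesis unfolding supp_subset_iff_overlap[OF A B]
  proof
    assume "dominated n A B"
    then obtain c where c: "c > 0" and ps: "psd n (B - complex_of_real c \<cdot>\<^sub>m A)"
      unfolding dominated_def by blast
    show "\<forall>i<n. \<forall>j<n. d i \<noteq> 0 \<longrightarrow> s j = 0 \<longrightarrow> overlap n V W i j = 0"
    proof (intro allI impI)
      fix i j assume ij: "i < n" "j < n" "d i \<noteq> 0" "s j = 0"
      define v where "v = col W j"
      have v: "v \<in> carrier_vec n" using Bc ij by (simp add: v_def)
      have "(B *\<^sub>v v) \<bullet>c v = of_real (\<Sum>k<n. s k * (cmod (if k = j then 1 else 0))\<^sup>2)"
        unfolding spectral_quad_form[OF B v] using ij Bc
        by (intro arg_cong[of _ _ of_real] sum.cong refl) (simp add: v_def coef_col overlap_self)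
      also have "\<dots> = 0"
        using ij by (auto intro!: sum.neutral)
      finally have Bv: "(B *\<^sub>v v) \<bullet>c v = 0" .
      have "((B - complex_of_real c \<cdot>\<^sub>m A) *\<^sub>v v) \<bullet>c v \<ge> 0"
        using ps v by (simp add: psd_def)
      then have "c * (\<Sum>k<n. d k * (cmod (coef n V v k))\<^sup>2) \<le> 0"
        unfolding quad_form_minus[OF Ac(1) Bc(1) v] Bv spectral_quad_form[OF A v]
        by (simp add: less_eq_complex_def)
      then have "(\<Sum>k<n. d k * (cmod (coef n V v k))\<^sup>2) \<le> 0"
        using c by (simp add: mult_le_0_iff)
      moreover have nn: "\<And>k. k \<in> {..<n} \<Longrightarrow> d k * (cmod (coef n V v k))\<^sup>2 \<ge> 0" using d by simp
      ultimately have "(\<Sum>k<n. d k * (cmod (coef n V v k))\<^sup>2) = 0"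
        using sum_nonneg[of "{..<n}" "\<lambda>k. d k * (cmod (coef n V v k))\<^sup>2"] by force
      then have "d i * (cmod (coef n V v i))\<^sup>2 = 0"
        using sum_nonneg_eq_0_iff[OF finite_lessThan nn] ij by auto
      then show "overlap n V W i j = 0"
        using ij Bc by (simp add: v_def coef_col)
    qed
  next
    assume ov: "\<forall>i<n. \<forall>j<n. d i \<noteq> 0 \<longrightarrow> s j = 0 \<longrightarrow> overlap n V W i j = 0"
    obtain c where c: "c > 0" "\<And>j. j < n \<Longrightarrow> s j > 0 \<Longrightarrow> c \<le> s j"
      using pos_lower_bound[of n s] by blast
    \<comment> \<open>An upper bound for the trace of \<open>A\<close>; the summand 1 keeps it
      positive when \<open>A\<close> is zero.\<close>
    define K where "K = (\<Sum>k<n. d k) + 1"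
    have K: "K > 0" unfolding K_def using d by (intro add_nonneg_pos sum_nonneg) auto
    have bound: "c * (cmod (coef n V v i))\<^sup>2 \<le> (\<Sum>j<n. s j * (cmod (coef n W v j))\<^sup>2)"
      if v: "v \<in> carrier_vec n" and i: "i < n" "d i \<noteq> 0" for v i
    proof -
      \<comment> \<open>Coordinates in the kernel of \<open>B\<close> are dropped; by
        \<open>ov\<close> their overlaps with the i-th eigenvector vanish.\<close>
      define f where "f j = (if s j = 0 then 0 else cmod (coef n W v j))" for j
      have "cmod (coef n V v i) \<le> (\<Sum>j<n. cmod (overlap n V W i j) * cmod (coef n W v j))"
        unfolding coef_expand[OF Bc(3) i(1), of V v] by (rule sum_norm_le) (simp add: norm_mult)
      also have "\<dots> = (\<Sum>j<n. cmod (overlap n V W i j) * f j)"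
        using ov i by (intro sum.cong refl) (auto simp: f_def)
      finally have "(cmod (coef n V v i))\<^sup>2 \<le> (\<Sum>j<n. cmod (overlap n V W i j) * f j)\<^sup>2"
        by (intro power_mono) auto
      also have "\<dots> \<le> (\<Sum>j<n. (f j)\<^sup>2)"
        using cauchy_schwarz_sum[of "\<lambda>j. cmod (overlap n V W i j)" f "{..<n}"]
          overlap_row_sum[OF Ac(3) Bc(3) i(1)] by simp
      finally have "c * (cmod (coef n V v i))\<^sup>2 \<le> (\<Sum>j<n. c * (f j)\<^sup>2)"
        using c by (simp add: sum_distrib_left[symmetric])
      also have "\<dots> \<le> (\<Sum>j<n. s j * (cmod (coef n W v j))\<^sup>2)"
        using c(2) s by (intro sum_mono) (auto simp: f_def less_le intro!: mult_right_mono)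
      finally show ?thesis .
    qed
    have "psd n (B - complex_of_real (c / K) \<cdot>\<^sub>m A)"
      unfolding psd_def
    proof (intro conjI ballI)
      show "B - complex_of_real (c / K) \<cdot>\<^sub>m A \<in> carrier_mat n n"
        using Ac Bc by (intro minus_carrier_mat smult_carrier_mat)
      fix v :: "complex vec" assume v: "v \<in> carrier_vec n"
      define Q where "Q = (\<Sum>j<n. s j * (cmod (coef n W v j))\<^sup>2)"
      have Q: "Q \<ge> 0" unfolding Q_def using s by (intro sum_nonneg) auto
      have "c * (\<Sum>i<n. d i * (cmod (coef n V v i))\<^sup>2) = (\<Sum>i<n. d i * (c * (cmod (coef n V v i))\<^sup>2))"
        by (simp add: sum_distrib_left mult_ac)
      also have "\<dots> \<le> (\<Sum>i<n. d i * Q)"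
      proof (rule sum_mono)
        fix i assume "i \<in> {..<n}"
        then show "d i * (c * (cmod (coef n V v i))\<^sup>2) \<le> d i * Q"
          using bound[OF v, of i] d[of i] by (cases "d i = 0") (auto simp: Q_def intro: mult_left_mono)
      qed
      also have "\<dots> \<le> K * Q"
        using Q by (simp add: K_def sum_distrib_right[symmetric] mult_right_mono)
      finally have "c / K * (\<Sum>i<n. d i * (cmod (coef n V v i))\<^sup>2) \<le> Q"
        using K by (simp add: field_simps)
      then show "((B - complex_of_real (c / K) \<cdot>\<^sub>m A) *\<^sub>v v) \<bullet>c v \<ge> 0"
        unfolding quad_form_minus[OF Ac(1) Bc(1) v] spectral_quad_form[OF A v] spectral_quad_form[OF B v]
          Q_def by (simp add: less_eq_complex_def)
    qed
    then show "dominated n A B"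
      unfolding dominated_def using c K by (intro exI[of _ "c / K"]) simp
  qed
qed

section \<open>Relative entropy\<close>

lemma mat_trace_minus:
  assumes "A \<in> carrier_mat n n" "B \<in> carrier_mat n n"
  shows "mat_trace (A - B) = mat_trace A - mat_trace B"
  using assms by (simp add: mat_trace_def sum_subtractf)

lemma mat_trace_mult_minus:
  assumes "A \<in> carrier_mat n n" "B \<in> carrier_mat n n" "C \<in> carrier_mat n n"
  shows "mat_trace (A * (B - C)) = mat_trace (A * B) - mat_trace (A * C)"
proof -
  have "A * (B - C) = A * B - A * C"
    by (rule mult_minus_distrib_mat[OF assms])
  then show ?thesis
    using mat_trace_minus[of "A * B" n "A * C"] assms by simp
qed

lemma mat_trace_mult_sum:
  assumes "A \<in> carrier_mat n n" "B \<in> carrier_mat n n"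
  shows "mat_trace (A * B) = (\<Sum>a<n. \<Sum>b<n. A $$ (a, b) * B $$ (b, a))"
  using assms by (auto simp: mat_trace_def mat_mult_index_sum[OF assms] simp del: index_mult_mat(1) intro!: sum.cong)

lemma mat_trace_mult_commute:
  assumes "A \<in> carrier_mat n n" "B \<in> carrier_mat n n"
  shows "mat_trace (A * B) = mat_trace (B * A)"
  unfolding mat_trace_mult_sum[OF assms] mat_trace_mult_sum[OF assms(2,1)]
  by (subst sum.swap) (simp add: mult.commute)

section \<open>Relative entropy as a double sum over eigenvalues\<close>

definition pos_ln :: "real \<Rightarrow> real" where
  "pos_ln x = (if x > 0 then ln x else 0)"

lemma spectral_mat_log: "spectral n A V d \<Longrightarrow> spectral n (mat_log A) V (\<lambda>i. pos_ln (d i))"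
  using spectral_mat_fun[of n A V d pos_ln] by (simp add: mat_log_def pos_ln_def[abs_def])

text \<open>The finite branch of \<open>rel_entropy\<close> as a real number, without the test on
  supports, so that averages and differences can be formed in the reals.\<close>

definition rel_entropy_real :: "complex mat \<Rightarrow> complex mat \<Rightarrow> real" where
  "rel_entropy_real \<rho> \<sigma> = Re (mat_trace (\<rho> * (mat_log \<rho> - mat_log \<sigma>)))"

lemma rel_entropy_eq_real: "supp \<rho> \<subseteq> supp \<sigma> \<Longrightarrow> rel_entropy \<rho> \<sigma> = ereal (rel_entropy_real \<rho> \<sigma>)"
  by (simp add: rel_entropy_def rel_entropy_real_def)

lemma spectral_trace_mult_self:
  assumes A: "spectral n A V d" and B: "spectral n B V s"
  shows "mat_trace (A * B) = of_real (\<Sum>i<n. d i * s i)"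
proof -
  have "(\<Sum>i<n. \<Sum>j<n. (cmod (overlap n V V i j))\<^sup>2 * (d i * s j)) = (\<Sum>i<n. d i * s i)"
  proof (rule sum.cong[OF refl])
    fix i assume i: "i \<in> {..<n}"
    have "(\<Sum>j<n. (cmod (overlap n V V i j))\<^sup>2 * (d i * s j)) = (\<Sum>j<n. if i = j then d i * s j else 0)"
      using i spectral_carrier[OF A] by (intro sum.cong refl) (simp add: overlap_self)
    then show "(\<Sum>j<n. (cmod (overlap n V V i j))\<^sup>2 * (d i * s j)) = d i * s i"
      using i by simp
  qed
  then show ?thesis by (simp only: spectral_trace_mult[OF A B])
qed

text \<open>For states with nested supports this is the classical relative entropy of the
  Nussbaum-Szkola weights |<x_i, y_j>|^2 d_i and |<x_i, y_j>|^2 s_j. The term with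
  \<open>pos_ln (d i)\<close> alone is spread over \<open>j\<close> by the row sums.\<close>

lemma rel_entropy_real_spectral:
  assumes A: "spectral n A V d" and B: "spectral n B W s"
  shows "rel_entropy_real A B =
    (\<Sum>i<n. \<Sum>j<n. (cmod (overlap n V W i j))\<^sup>2 * (d i * (pos_ln (d i) - pos_ln (s j))))"
proof -
  note Ac = spectral_carrier[OF A] and Bc = spectral_carrier[OF B]
  note lA = spectral_mat_log[OF A] and lB = spectral_mat_log[OF B]
  have "rel_entropy_real A B = (\<Sum>i<n. d i * pos_ln (d i))
      - (\<Sum>i<n. \<Sum>j<n. (cmod (overlap n V W i j))\<^sup>2 * (d i * pos_ln (s j)))"
    unfolding rel_entropy_real_def
      mat_trace_mult_minus[OF Ac(1) spectral_carrier(1)[OF lA] spectral_carrier(1)[OF lB]]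
      spectral_trace_mult[OF A lB] spectral_trace_mult_self[OF A lA] by simp
  also have "(\<Sum>i<n. d i * pos_ln (d i)) =
      (\<Sum>i<n. \<Sum>j<n. (cmod (overlap n V W i j))\<^sup>2 * (d i * pos_ln (d i)))"
    using overlap_row_sum[OF Ac(3) Bc(3)] by (simp add: sum_distrib_right[symmetric])
  finally show ?thesis
    by (simp add: sum_subtractf right_diff_distrib)
qed

text \<open>Both bounds come from \<open>ln z \<le> z - 1\<close>, at \<open>z = y / x\<close> and
  at \<open>z = x / y\<close>. The second gives
  \<open>x * (x / y - 1) = (x - y) + (x - y)\<^sup>2 / y\<close>; replacing \<open>y\<close> by
  \<open>c\<close> makes the estimate uniform over the positive eigenvalues.\<close>

lemma relative_term_bounds:
  fixes x y c :: real
  assumes "x \<ge> 0" "y > 0" "0 < c" "c \<le> y"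
  shows "x - y \<le> x * (pos_ln x - pos_ln y)"
    and "x * (pos_ln x - pos_ln y) \<le> (x - y) + (x - y)\<^sup>2 / c"
proof -
  show "x - y \<le> x * (pos_ln x - pos_ln y)"
  proof (cases "x = 0")
    case False
    then have x: "x > 0" using assms by simp
    have "ln (y / x) \<le> y / x - 1" using x assms by (intro ln_le_minus_one) simp
    then have "x * (ln y - ln x) \<le> x * (y / x - 1)"
      using x assms by (intro mult_left_mono) (auto simp: ln_div)
    also have "\<dots> = y - x" using x by (simp add: field_simps)
    finally show ?thesis using x assms by (simp add: pos_ln_def algebra_simps)
  qed (use assms in simp)
  have "(x - y) + (x - y)\<^sup>2 / y \<le> (x - y) + (x - y)\<^sup>2 / c"
    using assms by (intro add_left_mono divide_left_mono) auto
  moreover have "x * (pos_ln x - pos_ln y) \<le> (x - y) + (x - y)\<^sup>2 / y"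
  proof (cases "x = 0")
    case False
    then have x: "x > 0" using assms by simp
    have "ln (x / y) \<le> x / y - 1" using x assms by (intro ln_le_minus_one) simp
    then have "x * (ln x - ln y) \<le> x * (x / y - 1)"
      using x assms by (intro mult_left_mono) (auto simp: ln_div)
    also have "\<dots> = (x - y) + (x - y)\<^sup>2 / y"
      using assms by (simp add: field_simps power2_eq_square)
    finally show ?thesis using x assms by (simp add: pos_ln_def)
  qed (use assms in \<open>simp add: power2_eq_square\<close>)
  ultimately show "x * (pos_ln x - pos_ln y) \<le> (x - y) + (x - y)\<^sup>2 / c" by linarith
qed

text \<open>After expanding the square, the sums of \<open>d i * d i\<close> and
  \<open>s j * s j\<close> are spread over pairs by the row and column sums, which completes the
  squares \<open>(d i - s j)\<^sup>2\<close>.\<close>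

lemma spectral_trace_square_diff:
  assumes A: "spectral n A V d" and B: "spectral n B W s"
  shows "mat_trace ((A - B) * (A - B)) =
    of_real (\<Sum>i<n. \<Sum>j<n. (cmod (overlap n V W i j))\<^sup>2 * (d i - s j)\<^sup>2)"
proof -
  note Ac = spectral_carrier[OF A] and Bc = spectral_carrier[OF B]
  define w where "w i j = (cmod (overlap n V W i j))\<^sup>2" for i j
  have row: "(\<Sum>j<n. w i j) = 1" if "i < n" for i
    using overlap_row_sum[OF Ac(3) Bc(3) that] by (simp add: w_def)
  have col: "(\<Sum>i<n. w i j) = 1" if "j < n" for j
    using overlap_col_sum[OF Ac(3) Bc(3) that] by (simp add: w_def)
  have AB: "A - B \<in> carrier_mat n n" using Bc by (intro minus_carrier_mat)
  have "mat_trace ((A - B) * (A - B)) = mat_trace ((A - B) * A) - mat_trace ((A - B) * B)"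
    by (rule mat_trace_mult_minus[OF AB Ac(1) Bc(1)])
  also have "\<dots> = mat_trace (A * A) - mat_trace (A * B) - (mat_trace (B * A) - mat_trace (B * B))"
    by (simp add: mat_trace_mult_commute[OF AB] mat_trace_mult_minus[of _ n] Ac Bc)
  also have "\<dots> = of_real ((\<Sum>i<n. d i * d i) - 2 * (\<Sum>i<n. \<Sum>j<n. w i j * (d i * s j)) + (\<Sum>j<n. s j * s j))"
    by (simp add: mat_trace_mult_commute[OF Bc(1) Ac(1)] spectral_trace_mult[OF A B] w_def
      spectral_trace_mult_self[OF A A] spectral_trace_mult_self[OF B B])
  also have "(\<Sum>i<n. d i * d i) = (\<Sum>i<n. \<Sum>j<n. w i j * (d i * d i))"
    by (simp add: sum_distrib_right[symmetric] row)
  also have "(\<Sum>j<n. s j * s j) = (\<Sum>i<n. \<Sum>j<n. w i j * (s j * s j))"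
    by (subst sum.swap) (simp add: sum_distrib_right[symmetric] col)
  finally show ?thesis
    unfolding w_def[symmetric]
    by (simp add: power2_eq_square algebra_simps sum.distrib sum_subtractf sum_distrib_left)
qed

text \<open>Both bounds are termwise, over pairs of eigenvectors: the lower one is Klein's inequality, the
  upper one bounds the relative entropy by the \<open>\<chi>\<^sup>2\<close>-divergence and that by the squared
  Hilbert-Schmidt distance over the smallest nonzero eigenvalue of \<open>B\<close>.\<close>

lemma rel_entropy_real_bounds:
  assumes "psd n B"
  shows "\<exists>C. \<forall>A. psd n A \<longrightarrow> mat_trace A = mat_trace B \<longrightarrow> supp A \<subseteq> supp B \<longrightarrow>
    0 \<le> rel_entropy_real A B \<and> rel_entropy_real A B \<le> C * Re (mat_trace ((A - B) * (A - B)))"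
proof -
  from psd_spectral[OF assms] obtain W s
    where B: "spectral n B W s" and s: "\<And>k. k < n \<Longrightarrow> s k \<ge> 0" by blast
  obtain c where c: "c > 0" "\<And>j. j < n \<Longrightarrow> s j > 0 \<Longrightarrow> c \<le> s j"
    using pos_lower_bound[of n s] by blast
  have "0 \<le> rel_entropy_real A B \<and> rel_entropy_real A B \<le> 1 / c * Re (mat_trace ((A - B) * (A - B)))"
    if psA: "psd n A" and tr: "mat_trace A = mat_trace B" and sub: "supp A \<subseteq> supp B" for A
  proof -
    from psd_spectral[OF psA] obtain V d
      where A: "spectral n A V d" and d: "\<And>k. k < n \<Longrightarrow> d k \<ge> 0" by blast
    note Ac = spectral_carrier[OF A] and Bc = spectral_carrier[OF B]
    define w where "w i j = (cmod (overlap n V W i j))\<^sup>2" for i j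
    have row: "(\<Sum>j<n. w i j) = 1" if "i < n" for i
      using overlap_row_sum[OF Ac(3) Bc(3) that] by (simp add: w_def)
    have col: "(\<Sum>i<n. w i j) = 1" if "j < n" for j
      using overlap_col_sum[OF Ac(3) Bc(3) that] by (simp add: w_def)
    have "(\<Sum>i<n. d i) = (\<Sum>i<n. s i)"
      using tr unfolding spectral_trace[OF A] spectral_trace[OF B] of_real_eq_iff .
    moreover have "(\<Sum>i<n. d i) = (\<Sum>i<n. \<Sum>j<n. w i j * d i)"
      by (simp add: sum_distrib_right[symmetric] row)
    moreover have "(\<Sum>j<n. s j) = (\<Sum>i<n. \<Sum>j<n. w i j * s j)"
      by (subst sum.swap) (simp add: sum_distrib_right[symmetric] col)
    \<comment> \<open>Equal traces make the first-order terms cancel. Hence the lower bounds sum to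
      0 and only the quadratic part of the upper bounds remains.\<close>
    ultimately have zero: "(\<Sum>i<n. \<Sum>j<n. w i j * (d i - s j)) = 0"
      by (simp add: right_diff_distrib sum_subtractf)
    have bnd: "w i j * (d i - s j) \<le> w i j * (d i * (pos_ln (d i) - pos_ln (s j))) \<and>
        w i j * (d i * (pos_ln (d i) - pos_ln (s j))) \<le> w i j * ((d i - s j) + (d i - s j)\<^sup>2 / c)"
      if ij: "i < n" "j < n" for i j
    proof (cases "s j = 0")
      \<comment> \<open>If \<open>s j = 0\<close>, the support inclusion forces
        \<open>d i = 0\<close> or a zero weight, and all three expressions vanish.\<close>
      case True
      then show ?thesis
        using sub[unfolded supp_subset_iff_overlap[OF A B]] ij c(1)
        by (cases "d i = 0") (auto simp: w_def)
    next
      case False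
      then have "s j > 0" using s[OF ij(2)] by simp
      then show ?thesis
        using relative_term_bounds[of "d i" "s j" c] d[OF ij(1)] c ij
        by (auto simp: w_def intro!: mult_left_mono)
    qed
    have RE: "rel_entropy_real A B = (\<Sum>i<n. \<Sum>j<n. w i j * (d i * (pos_ln (d i) - pos_ln (s j))))"
      unfolding w_def by (rule rel_entropy_real_spectral[OF A B])
    have "0 \<le> rel_entropy_real A B"
      unfolding RE zero[symmetric] using bnd by (intro sum_mono) auto
    moreover have "rel_entropy_real A B \<le> (\<Sum>i<n. \<Sum>j<n. w i j * ((d i - s j) + (d i - s j)\<^sup>2 / c))"
      unfolding RE using bnd by (intro sum_mono) auto
    moreover have "\<dots> = 1 / c * Re (mat_trace ((A - B) * (A - B)))"
      unfolding spectral_trace_square_diff[OF A B] distrib_left sum.distrib zero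
      by (simp add: w_def sum_divide_distrib)
    ultimately show ?thesis by simp
  qed
  then show ?thesis by blast
qed

section \<open>Classical-quantum states\<close>

lemma index_less_mult: "i < m \<Longrightarrow> a < n \<Longrightarrow> i * n + a < m * (n :: nat)"
proof -
  assume "i < m" "a < n"
  then have "i * n + a < Suc i * n" by simp
  also have "\<dots> \<le> m * n" using \<open>i < m\<close> by (intro mult_le_mono1) simp
  finally show ?thesis .
qed

lemma mod_less_mult: "(k :: nat) < m * n \<Longrightarrow> k mod n < n"
  by (cases "n = 0") auto

text \<open>The index encoding \<open>k = i * n + j\<close> of a tensor product as a bijection. For
  \<open>n = 0\<close> both sides are 0.\<close>

lemma sum_div_mod:
  fixes f :: "nat \<Rightarrow> nat \<Rightarrow> 'a :: comm_monoid_add"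
  shows "(\<Sum>k<m * n. f (k div n) (k mod n)) = (\<Sum>i<m. \<Sum>j<n. f i j)"
proof -
  have "(\<Sum>i<m. \<Sum>j<n. f i j) = (\<Sum>(i, j)\<in>{..<m} \<times> {..<n}. f i j)"
    by (rule sum.cartesian_product)
  also have "\<dots> = (\<Sum>k<m * n. f (k div n) (k mod n))"
    by (rule sum.reindex_bij_witness[of _ "\<lambda>k. (k div n, k mod n)" "\<lambda>(i, j). i * n + j"])
      (auto simp: index_less_mult less_mult_imp_div_less mod_less_mult)
  finally show ?thesis ..
qed

text \<open>The matrix inside \<open>cq_state\<close> with its witnesses as parameters. A constant
  family gives the product matrices needed for the mutual information.\<close>

definition cq_mat ::
    "nat \<Rightarrow> nat \<Rightarrow> (nat \<Rightarrow> complex vec) \<Rightarrow> (nat \<Rightarrow> real) \<Rightarrow> (nat \<Rightarrow> complex mat) \<Rightarrow> complex mat" where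
  "cq_mat dU n e p \<tau> = mat (dU * n) (dU * n)
     (\<lambda>ij. \<Sum>u<dU. (complex_of_real (p u) \<cdot>\<^sub>m kron (ketbra (e u)) (\<tau> u)) $$ ij)"

definition mixture :: "nat \<Rightarrow> nat \<Rightarrow> (nat \<Rightarrow> real) \<Rightarrow> (nat \<Rightarrow> complex mat) \<Rightarrow> complex mat" where
  "mixture dU n p \<tau> = mat n n (\<lambda>ij. \<Sum>u<dU. complex_of_real (p u) * \<tau> u $$ ij)"

text \<open>Column \<open>u * n + k\<close> is \<open>e u\<close> tensored with the k-th column of
  \<open>Vs u\<close>: the basis of the second factor may depend on \<open>u\<close>.\<close>

definition cq_basis :: "nat \<Rightarrow> nat \<Rightarrow> (nat \<Rightarrow> complex vec) \<Rightarrow> (nat \<Rightarrow> complex mat) \<Rightarrow> complex mat" where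
  "cq_basis dU n e Vs = mat (dU * n) (dU * n)
     (\<lambda>(a, k). e (k div n) $ (a div n) * Vs (k div n) $$ (a mod n, k mod n))"

lemma cq_mat_carrier [simp]: "cq_mat dU n e p \<tau> \<in> carrier_mat (dU * n) (dU * n)"
  by (simp add: cq_mat_def)

lemma mixture_carrier [simp]: "mixture dU n p \<tau> \<in> carrier_mat n n"
  by (simp add: mixture_def)

context
  fixes dU :: nat and e :: "nat \<Rightarrow> complex vec"
  assumes onb: "orthonormal_basis dU e"
begin

lemma onb_carrier: "u < dU \<Longrightarrow> e u \<in> carrier_vec dU"
  using onb by (simp add: orthonormal_basis_def)

lemma onb_sum:
  assumes "u < dU" "v < dU"
  shows "(\<Sum>a<dU. e u $ a * cnj (e v $ a)) = (if u = v then 1 else 0)"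
proof -
  have "e u \<bullet>c e v = (\<Sum>a<dU. e u $ a * cnj (e v $ a))"
    using onb_carrier[OF assms(2)] by (intro cscalar_prod_sum) simp
  then show ?thesis using onb assms by (simp add: orthonormal_basis_def)
qed

lemma cq_mat_index:
  assumes "\<And>u. u < dU \<Longrightarrow> \<tau> u \<in> carrier_mat n n" "i < dU * n" "j < dU * n"
  shows "cq_mat dU n e p \<tau> $$ (i, j) = (\<Sum>u<dU. of_real (p u) *
    (e u $ (i div n) * cnj (e u $ (j div n))) * \<tau> u $$ (i mod n, j mod n))"
proof -
  have "(complex_of_real (p u) \<cdot>\<^sub>m kron (ketbra (e u)) (\<tau> u)) $$ (i, j) =
      of_real (p u) * (e u $ (i div n) * cnj (e u $ (j div n))) * \<tau> u $$ (i mod n, j mod n)"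
    if u: "u < dU" for u
  proof -
    have "dim_vec (e u) = dU" "dim_row (\<tau> u) = n" "dim_col (\<tau> u) = n"
      using onb_carrier[OF u] assms(1)[OF u] by auto
    then show ?thesis
      using assms(2,3) by (simp add: kron_def ketbra_def less_mult_imp_div_less)
  qed
  then show ?thesis using assms(2,3) by (simp add: cq_mat_def)
qed

text \<open>Orthogonality of the \<open>e u\<close> makes the transition matrix block
  diagonal.\<close>

lemma cq_overlap:
  assumes i: "i < dU * n" and j: "j < dU * n"
  shows "overlap (dU * n) (cq_basis dU n e Vs) (cq_basis dU n e Ws) i j =
    (if i div n = j div n then overlap n (Vs (i div n)) (Ws (i div n)) (i mod n) (j mod n) else 0)"
proof -
  let ?u = "i div n" and ?v = "j div n"
  have u: "?u < dU" "?v < dU" using i j by (auto simp: less_mult_imp_div_less)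
  have "overlap (dU * n) (cq_basis dU n e Vs) (cq_basis dU n e Ws) i j =
     (\<Sum>k<dU * n. (\<lambda>a b. (e ?v $ a * cnj (e ?u $ a)) *
        (cnj (Vs ?u $$ (b, i mod n)) * Ws ?v $$ (b, j mod n))) (k div n) (k mod n))"
    unfolding overlap_def by (intro sum.cong refl) (use i j in \<open>simp add: cq_basis_def\<close>)
  also have "\<dots> = (\<Sum>a<dU. e ?v $ a * cnj (e ?u $ a)) * overlap n (Vs ?u) (Ws ?v) (i mod n) (j mod n)"
    by (subst sum_div_mod[of "\<lambda>a b. (e ?v $ a * cnj (e ?u $ a)) *
        (cnj (Vs ?u $$ (b, i mod n)) * Ws ?v $$ (b, j mod n))"]) (simp add: overlap_def sum_product)
  finally show ?thesis using onb_sum[OF u(2,1)] by auto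
qed

lemma cq_basis_unitary:
  assumes "\<And>u. u < dU \<Longrightarrow> unitary_mat n (Vs u)"
  shows "unitary_mat (dU * n) (cq_basis dU n e Vs)"
  unfolding unitary_mat_iff
proof (intro conjI allI impI)
  show "cq_basis dU n e Vs \<in> carrier_mat (dU * n) (dU * n)" by (simp add: cq_basis_def)
  fix i j assume ij: "i < dU * n" "j < dU * n"
  then have "overlap (dU * n) (cq_basis dU n e Vs) (cq_basis dU n e Vs) i j =
      (if i div n = j div n \<and> i mod n = j mod n then 1 else 0)"
    using assms by (auto simp: cq_overlap overlap_self less_mult_imp_div_less mod_less_mult)
  also have "(i div n = j div n \<and> i mod n = j mod n) \<longleftrightarrow> i = j"
    by (metis div_mult_mod_eq)
  finally show "(\<Sum>k<dU * n. cnj (cq_basis dU n e Vs $$ (k, i)) * cq_basis dU n e Vs $$ (k, j)) =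
      (if i = j then 1 else 0)" by (simp only: overlap_def)
qed

lemma cq_spectral:
  assumes sp: "\<And>u. u < dU \<Longrightarrow> spectral n (\<tau> u) (Vs u) (r u)"
  shows "spectral (dU * n) (cq_mat dU n e p \<tau>) (cq_basis dU n e Vs)
    (\<lambda>k. p (k div n) * r (k div n) (k mod n))"
  unfolding spectral_def
proof (intro conjI allI impI cq_mat_carrier)
  show "unitary_mat (dU * n) (cq_basis dU n e Vs)"
    by (rule cq_basis_unitary) (use spectral_carrier[OF sp] in blast)
  fix i j assume ij: "i < dU * n" "j < dU * n"
  have c: "\<tau> u \<in> carrier_mat n n" if "u < dU" for u
    using spectral_carrier[OF sp[OF that]] by blast
  have "(\<Sum>k<dU * n. cq_basis dU n e Vs $$ (i, k) * of_real (p (k div n) * r (k div n) (k mod n)) *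
        cnj (cq_basis dU n e Vs $$ (j, k))) =
      (\<Sum>k<dU * n. (\<lambda>u l. of_real (p u) * (e u $ (i div n) * cnj (e u $ (j div n))) *
        (Vs u $$ (i mod n, l) * of_real (r u l) * cnj (Vs u $$ (j mod n, l)))) (k div n) (k mod n))"
    by (intro sum.cong refl) (use ij in \<open>simp add: cq_basis_def mult_ac\<close>)
  also have "\<dots> = cq_mat dU n e p \<tau> $$ (i, j)"
  proof (subst cq_mat_index[where \<tau> = \<tau>, OF c ij], assumption, subst sum_div_mod[of "\<lambda>u l. of_real (p u) * (e u $ (i div n) * cnj (e u $ (j div n))) *
        (Vs u $$ (i mod n, l) * of_real (r u l) * cnj (Vs u $$ (j mod n, l)))"], intro sum.cong refl)
    fix u assume "u \<in> {..<dU}"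
    then have "\<tau> u $$ (i mod n, j mod n) =
        (\<Sum>l<n. Vs u $$ (i mod n, l) * of_real (r u l) * cnj (Vs u $$ (j mod n, l)))"
      using sp[of u] ij by (simp add: spectral_def mod_less_mult)
    then show "(\<Sum>l<n. of_real (p u) * (e u $ (i div n) * cnj (e u $ (j div n))) *
        (Vs u $$ (i mod n, l) * of_real (r u l) * cnj (Vs u $$ (j mod n, l)))) =
        of_real (p u) * (e u $ (i div n) * cnj (e u $ (j div n))) * \<tau> u $$ (i mod n, j mod n)"
      by (simp only: sum_distrib_left)
  qed
  finally show "cq_mat dU n e p \<tau> $$ (i, j) =
      (\<Sum>k<dU * n. cq_basis dU n e Vs $$ (i, k) * of_real (p (k div n) * r (k div n) (k mod n)) *
        cnj (cq_basis dU n e Vs $$ (j, k)))" ..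
qed

text \<open>Both matrices are block diagonal over \<open>u\<close> and carry the factor
  \<open>p u\<close> in block \<open>u\<close>, which cancels in the difference of the logarithms.
  Supports are compared only where \<open>p u > 0\<close>, since a member of weight zero may lie
  anywhere.\<close>

lemma cq_mat_rel_entropy:
  assumes p: "\<And>u. u < dU \<Longrightarrow> p u \<ge> 0"
    and \<tau>: "\<And>u. u < dU \<Longrightarrow> psd n (\<tau> u)" and B: "psd n B"
    and sub: "\<And>u. u < dU \<Longrightarrow> p u > 0 \<Longrightarrow> supp (\<tau> u) \<subseteq> supp B"
  shows "rel_entropy (cq_mat dU n e p \<tau>) (cq_mat dU n e p (\<lambda>_. B)) =
    ereal (\<Sum>u<dU. p u * rel_entropy_real (\<tau> u) B)"
proof -
  have "\<forall>u. \<exists>V d. u < dU \<longrightarrow> spectral n (\<tau> u) V d \<and> (\<forall>k<n. d k \<ge> 0)"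
    using psd_spectral[OF \<tau>] by metis
  then obtain Vs r where Vs: "\<And>u. u < dU \<Longrightarrow> spectral n (\<tau> u) (Vs u) (r u)"
    and r: "\<And>u k. u < dU \<Longrightarrow> k < n \<Longrightarrow> r u k \<ge> 0" by metis
  from psd_spectral[OF B] obtain W s
    where W: "spectral n B W s" and s: "\<And>k. k < n \<Longrightarrow> s k \<ge> 0" by blast
  let ?A = "cq_mat dU n e p \<tau>" and ?B = "cq_mat dU n e p (\<lambda>_. B)"
  let ?V = "cq_basis dU n e Vs" and ?W = "cq_basis dU n e (\<lambda>_. W)"
  let ?d = "\<lambda>k. p (k div n) * r (k div n) (k mod n)" and ?s = "\<lambda>k. p (k div n) * s (k mod n)"
  have A': "spectral (dU * n) ?A ?V ?d" by (rule cq_spectral) (rule Vs)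
  have B': "spectral (dU * n) ?B ?W ?s" by (rule cq_spectral) (rule W)
  have ov0: "overlap n (Vs u) W i j = 0"
    if "u < dU" "p u \<noteq> 0" "i < n" "j < n" "r u i \<noteq> 0" "s j = 0" for u i j
    using sub[of u] p[of u] that unfolding supp_subset_iff_overlap[OF Vs[OF that(1)] W] by auto
  have "supp ?A \<subseteq> supp ?B"
    unfolding supp_subset_iff_overlap[OF A' B']
  proof (intro allI impI)
    fix i j assume *: "i < dU * n" "j < dU * n" "?d i \<noteq> 0" "?s j = 0"
    then show "overlap (dU * n) ?V ?W i j = 0"
      using ov0[of "i div n" "i mod n" "j mod n"]
      by (auto simp: cq_overlap less_mult_imp_div_less mod_less_mult)
  qed
  moreover have "rel_entropy_real ?A ?B = (\<Sum>u<dU. p u * rel_entropy_real (\<tau> u) B)"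
  proof -
    let ?f = "\<lambda>u i j. (cmod (overlap n (Vs u) W i j))\<^sup>2 *
        (p u * r u i * (pos_ln (p u * r u i) - pos_ln (p u * s j)))"
    have "rel_entropy_real ?A ?B =
        (\<Sum>k<dU * n. \<Sum>l<dU * n. (cmod (overlap (dU * n) ?V ?W k l))\<^sup>2 * (?d k * (pos_ln (?d k) - pos_ln (?s l))))"
      by (rule rel_entropy_real_spectral[OF A' B'])
    also have "\<dots> = (\<Sum>k<dU * n. \<Sum>l<dU * n.
        (\<lambda>v j. if k div n = v then ?f (k div n) (k mod n) j else 0) (l div n) (l mod n))"
      by (intro sum.cong refl) (simp add: cq_overlap)
    also have "\<dots> = (\<Sum>k<dU * n. \<Sum>j<n. ?f (k div n) (k mod n) j)"
    proof (rule sum.cong[OF refl])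
      fix k assume "k \<in> {..<dU * n}"
      then have "k div n < dU" by (simp add: less_mult_imp_div_less)
      moreover have "(\<Sum>v<dU. \<Sum>j<n. if k div n = v then ?f (k div n) (k mod n) j else 0) =
          (\<Sum>v<dU. if k div n = v then \<Sum>j<n. ?f (k div n) (k mod n) j else 0)"
        by (intro sum.cong refl) simp
      ultimately show "(\<Sum>l<dU * n. (\<lambda>v j. if k div n = v then ?f (k div n) (k mod n) j else 0) (l div n) (l mod n)) =
          (\<Sum>j<n. ?f (k div n) (k mod n) j)"
        by (subst sum_div_mod[of "\<lambda>v j. if k div n = v then ?f (k div n) (k mod n) j else 0"]) simp
    qed
    also have "\<dots> = (\<Sum>u<dU. \<Sum>i<n. \<Sum>j<n. ?f u i j)"
      by (rule sum_div_mod[of "\<lambda>u i. \<Sum>j<n. ?f u i j"])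
    also have "\<dots> = (\<Sum>u<dU. p u * rel_entropy_real (\<tau> u) B)"
    proof (intro sum.cong refl)
      fix u assume "u \<in> {..<dU}"
      then have u: "u < dU" by simp
      have "?f u i j = p u * ((cmod (overlap n (Vs u) W i j))\<^sup>2 * (r u i * (pos_ln (r u i) - pos_ln (s j))))"
        if ij: "i < n" "j < n" for i j
      proof (cases "p u = 0 \<or> r u i = 0 \<or> s j = 0")
        \<comment> \<open>Logarithms of products split only for positive factors. Here both sides
          vanish instead: if \<open>s j = 0\<close> while \<open>p u\<close> and
          \<open>r u i\<close> are nonzero, the overlap is 0.\<close>
        case True
        then show ?thesis using ov0[OF u _ ij] by auto
      next
        case False
        then have "p u > 0" "r u i > 0" "s j > 0"
          using p[OF u] r[OF u ij(1)] s[OF ij(2)] by auto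
        then show ?thesis by (simp add: pos_ln_def ln_mult)
      qed
      then show "(\<Sum>i<n. \<Sum>j<n. ?f u i j) = p u * rel_entropy_real (\<tau> u) B"
        unfolding rel_entropy_real_spectral[OF Vs[OF u] W] sum_distrib_left
        by (intro sum.cong refl) auto
    qed
    finally show ?thesis .
  qed
  ultimately show ?thesis by (simp add: rel_entropy_eq_real)
qed

lemma ptrace_fst_cq_mat:
  assumes "\<And>u. u < dU \<Longrightarrow> \<tau> u \<in> carrier_mat n n"
  shows "ptrace_fst dU n (cq_mat dU n e p \<tau>) = mixture dU n p \<tau>"
proof (rule eq_matI)
  fix a b assume "a < dim_row (mixture dU n p \<tau>)" "b < dim_col (mixture dU n p \<tau>)"
  then have ab: "a < n" "b < n" by (auto simp: mixture_def)
  then have "ptrace_fst dU n (cq_mat dU n e p \<tau>) $$ (a, b) =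
      (\<Sum>i<dU. \<Sum>u<dU. of_real (p u) * (e u $ i * cnj (e u $ i)) * \<tau> u $$ (a, b))"
    by (simp add: ptrace_fst_def cq_mat_index[OF assms] index_less_mult)
  also have "\<dots> = (\<Sum>u<dU. of_real (p u) * (\<Sum>i<dU. e u $ i * cnj (e u $ i)) * \<tau> u $$ (a, b))"
    by (subst sum.swap) (simp add: sum_distrib_left sum_distrib_right)
  also have "\<dots> = mixture dU n p \<tau> $$ (a, b)"
    using ab by (simp add: mixture_def onb_sum)
  finally show "ptrace_fst dU n (cq_mat dU n e p \<tau>) $$ (a, b) = mixture dU n p \<tau> $$ (a, b)" .
qed (auto simp: ptrace_fst_def mixture_def)

text \<open>Tensoring the marginal on U with \<open>B\<close> yields a constant family, so both
  arguments of the mutual information have the same block structure.\<close>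

lemma kron_ptrace_snd_cq_mat:
  assumes \<tau>: "\<And>u. u < dU \<Longrightarrow> \<tau> u \<in> carrier_mat n n" "\<And>u. u < dU \<Longrightarrow> mat_trace (\<tau> u) = 1"
    and B: "B \<in> carrier_mat n n"
  shows "kron (ptrace_snd dU n (cq_mat dU n e p \<tau>)) B = cq_mat dU n e p (\<lambda>_. B)"
proof (rule eq_matI)
  have P: "ptrace_snd dU n (cq_mat dU n e p \<tau>) $$ (i, j) =
      (\<Sum>u<dU. of_real (p u) * (e u $ i * cnj (e u $ j)))" if "i < dU" "j < dU" for i j
  proof -
    have "ptrace_snd dU n (cq_mat dU n e p \<tau>) $$ (i, j) =
        (\<Sum>a<n. \<Sum>u<dU. of_real (p u) * (e u $ i * cnj (e u $ j)) * \<tau> u $$ (a, a))"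
      using that by (simp add: ptrace_snd_def cq_mat_index[OF \<tau>(1)] index_less_mult)
    also have "\<dots> = (\<Sum>u<dU. of_real (p u) * (e u $ i * cnj (e u $ j)) * mat_trace (\<tau> u))"
      by (subst sum.swap, intro sum.cong refl) (use \<tau>(1) in \<open>auto simp: mat_trace_def sum_distrib_left\<close>)
    finally show ?thesis using \<tau>(2) by simp
  qed
  fix i j assume "i < dim_row (cq_mat dU n e p (\<lambda>_. B))" "j < dim_col (cq_mat dU n e p (\<lambda>_. B))"
  then have ij: "i < dU * n" "j < dU * n" by (auto simp: cq_mat_def)
  then have "kron (ptrace_snd dU n (cq_mat dU n e p \<tau>)) B $$ (i, j) =
      ptrace_snd dU n (cq_mat dU n e p \<tau>) $$ (i div n, j div n) * B $$ (i mod n, j mod n)"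
    using B by (auto simp: kron_def ptrace_snd_def)
  also have "\<dots> = cq_mat dU n e p (\<lambda>_. B) $$ (i, j)"
    using ij by (simp add: P cq_mat_index[OF B] less_mult_imp_div_less sum_distrib_right)
  finally show "kron (ptrace_snd dU n (cq_mat dU n e p \<tau>)) B $$ (i, j) = cq_mat dU n e p (\<lambda>_. B) $$ (i, j)" .
qed (use B in \<open>auto simp: kron_def ptrace_snd_def cq_mat_def\<close>)

end

lemma psd_carrier: "psd n A \<Longrightarrow> A \<in> carrier_mat n n"
  by (simp add: psd_def)

lemma quad_form_mixture:
  assumes \<tau>: "\<And>u. u < dU \<Longrightarrow> \<tau> u \<in> carrier_mat n n" and v: "v \<in> carrier_vec n"
  shows "(mixture dU n p \<tau> *\<^sub>v v) \<bullet>c v = (\<Sum>u<dU. of_real (p u) * ((\<tau> u *\<^sub>v v) \<bullet>c v))"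
proof -
  have "(mixture dU n p \<tau> *\<^sub>v v) \<bullet>c v =
      (\<Sum>i<n. \<Sum>j<n. \<Sum>u<dU. of_real (p u) * (\<tau> u $$ (i, j) * v $ j * cnj (v $ i)))"
    unfolding quad_form_sum[OF mixture_carrier v]
    by (intro sum.cong refl) (simp add: mixture_def sum_distrib_left sum_distrib_right mult_ac)
  also have "\<dots> = (\<Sum>u<dU. \<Sum>i<n. \<Sum>j<n. of_real (p u) * (\<tau> u $$ (i, j) * v $ j * cnj (v $ i)))"
    by (subst (2) sum.swap, subst sum.swap, rule refl)
  also have "\<dots> = (\<Sum>u<dU. of_real (p u) * ((\<tau> u *\<^sub>v v) \<bullet>c v))"
    using \<tau> by (intro sum.cong refl) (simp add: quad_form_sum[OF _ v] sum_distrib_left)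
  finally show ?thesis .
qed

lemma mixture_psd:
  assumes "\<And>u. u < dU \<Longrightarrow> p u \<ge> 0" "\<And>u. u < dU \<Longrightarrow> psd n (\<tau> u)"
  shows "psd n (mixture dU n p \<tau>)"
  unfolding psd_def
proof (intro conjI ballI mixture_carrier)
  fix v :: "complex vec" assume v: "v \<in> carrier_vec n"
  show "(mixture dU n p \<tau> *\<^sub>v v) \<bullet>c v \<ge> 0"
    using assms v psd_carrier[OF assms(2)]
    by (auto simp: quad_form_mixture psd_def less_eq_complex_def intro!: sum_nonneg sum.neutral)
qed

text \<open>Subtracting the u-th summand from the mixture leaves the other summands, which are
  positive semidefinite; so \<open>p u\<close> itself is a domination constant.\<close>

lemma supp_subset_mixture:
  assumes p: "\<And>u. u < dU \<Longrightarrow> p u \<ge> 0" and \<tau>: "\<And>u. u < dU \<Longrightarrow> psd n (\<tau> u)"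
    and u: "u < dU" "p u > 0"
  shows "supp (\<tau> u) \<subseteq> supp (mixture dU n p \<tau>)"
proof -
  note c = psd_carrier[OF \<tau>]
  have "psd n (mixture dU n p \<tau> - complex_of_real (p u) \<cdot>\<^sub>m \<tau> u)"
    unfolding psd_def
  proof (intro conjI ballI)
    show "mixture dU n p \<tau> - complex_of_real (p u) \<cdot>\<^sub>m \<tau> u \<in> carrier_mat n n"
      using c[OF u(1)] by (intro minus_carrier_mat smult_carrier_mat)
    fix v :: "complex vec" assume v: "v \<in> carrier_vec n"
    have "(mixture dU n p \<tau> *\<^sub>v v) \<bullet>c v = (\<Sum>w<dU. of_real (p w) * ((\<tau> w *\<^sub>v v) \<bullet>c v))"
      by (rule quad_form_mixture[OF c v])
    then have "((mixture dU n p \<tau> - complex_of_real (p u) \<cdot>\<^sub>m \<tau> u) *\<^sub>v v) \<bullet>c v =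
        (\<Sum>w\<in>{..<dU} - {u}. of_real (p w) * ((\<tau> w *\<^sub>v v) \<bullet>c v))"
      unfolding quad_form_minus[OF c[OF u(1)] mixture_carrier v]
      using u by (simp add: sum_diff1)
    then show "((mixture dU n p \<tau> - complex_of_real (p u) \<cdot>\<^sub>m \<tau> u) *\<^sub>v v) \<bullet>c v \<ge> 0"
      using p \<tau> v by (auto simp: psd_def less_eq_complex_def intro!: sum_nonneg sum.neutral)
  qed
  then have "dominated n (\<tau> u) (mixture dU n p \<tau>)"
    using u unfolding dominated_def by blast
  then show ?thesis
    using dominated_iff_supp[OF \<tau>[OF u(1)] mixture_psd[of dU p n \<tau>]] p \<tau> by blast
qed

text \<open>The mutual information of a classical-quantum state is the Holevo quantity of its
  ensemble, the average relative entropy to the mean state.\<close>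

lemma mutual_info_cq_mat:
  assumes onb: "orthonormal_basis dU e" and p: "\<And>u. u < dU \<Longrightarrow> p u \<ge> 0"
    and \<tau>: "\<And>u. u < dU \<Longrightarrow> quantum_state n (\<tau> u)"
  shows "mutual_info dU n (cq_mat dU n e p \<tau>) =
    ereal (\<Sum>u<dU. p u * rel_entropy_real (\<tau> u) (mixture dU n p \<tau>))"
proof -
  have ps: "psd n (\<tau> u)" "\<tau> u \<in> carrier_mat n n" "mat_trace (\<tau> u) = 1" if "u < dU" for u
    using \<tau>[OF that] by (auto simp: quantum_state_def psd_def)
  show ?thesis
    unfolding mutual_info_def
    apply (subst ptrace_fst_cq_mat[OF onb ps(2)], assumption)
    apply (subst kron_ptrace_snd_cq_mat[OF onb ps(2,3) mixture_carrier], assumption+)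
    by (rule cq_mat_rel_entropy[OF onb p ps(1) mixture_psd[OF p ps(1)] supp_subset_mixture[OF p ps(1)]])
qed

section \<open>Channels and partial traces\<close>

text \<open>\<open>K a b i j\<close> is the entry \<open>(i, j)\<close> of the image of the matrix
  unit at \<open>(a, b)\<close>. The expansion turns the exchange of \<Phi> with a finite sum of
  matrices into an exchange of sums of complex numbers.\<close>

lemma linear_map_mat_kernel:
  assumes lin: "linear_map_mat m n \<Phi>"
  shows "\<exists>K. \<forall>X\<in>carrier_mat m m. \<forall>i<n. \<forall>j<n.
    \<Phi> X $$ (i, j) = (\<Sum>a<m. \<Sum>b<m. X $$ (a, b) * K a b i j)"
proof -
  define E :: "nat \<times> nat \<Rightarrow> complex mat" where "E x = mat m m (\<lambda>y. if y = x then 1 else 0)" for x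
  have car: "\<Phi> X \<in> carrier_mat n n" and add: "\<Phi> (X + Y) = \<Phi> X + \<Phi> Y"
    and smult: "\<Phi> (c \<cdot>\<^sub>m X) = c \<cdot>\<^sub>m \<Phi> X"
    if "X \<in> carrier_mat m m" "Y \<in> carrier_mat m m" for X Y c
    using lin that by (auto simp: linear_map_mat_def)
  have E: "E x \<in> carrier_mat m m" for x by (simp add: E_def)
  have "\<Phi> X $$ (i, j) = (\<Sum>a<m. \<Sum>b<m. X $$ (a, b) * \<Phi> (E (a, b)) $$ (i, j))"
    if X: "X \<in> carrier_mat m m" and ij: "i < n" "j < n" for X i j
  proof -
    \<comment> \<open>\<open>R S\<close> keeps the entries of \<open>X\<close> at the positions in
      \<open>S\<close>; adding one position at a time uses additivity and homogeneity only.\<close>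
    define R where "R S = mat m m (\<lambda>y. if y \<in> S then X $$ y else 0)" for S
    have R: "R S \<in> carrier_mat m m" for S by (simp add: R_def)
    have step: "\<Phi> (R S) $$ (i, j) = (\<Sum>x\<in>S. X $$ x * \<Phi> (E x) $$ (i, j))" if "finite S" for S
      using that
    proof (induction S rule: finite_induct)
      case empty
      \<comment> \<open>The zero matrix is 0 times itself, so homogeneity gives its image.\<close>
      have "R {} = 0 \<cdot>\<^sub>m R {}" by (rule eq_matI) (auto simp: R_def)
      then have "\<Phi> (R {}) = 0 \<cdot>\<^sub>m \<Phi> (R {})" using smult[OF R R] by metis
      then have "\<Phi> (R {}) $$ (i, j) = 0 * \<Phi> (R {}) $$ (i, j)"
        using car[OF R R] ij by (metis carrier_matD index_smult_mat(1))
      then show ?case by simp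
    next
      case (insert x S)
      have "R (insert x S) = X $$ x \<cdot>\<^sub>m E x + R S"
        using insert(2) by (intro eq_matI) (auto simp: R_def E_def)
      then have "\<Phi> (R (insert x S)) = X $$ x \<cdot>\<^sub>m \<Phi> (E x) + \<Phi> (R S)"
        using add[of "X $$ x \<cdot>\<^sub>m E x" "R S"] smult[OF E E] E R by simp
      then have "\<Phi> (R (insert x S)) $$ (i, j) = X $$ x * \<Phi> (E x) $$ (i, j) + \<Phi> (R S) $$ (i, j)"
        using car[OF E E, of x] car[OF R R, of S] ij by simp
      then show ?case using insert by simp
    qed
    have "X = R ({..<m} \<times> {..<m})"
      using X by (intro eq_matI) (auto simp: R_def)
    then have "\<Phi> X $$ (i, j) = (\<Sum>x\<in>{..<m} \<times> {..<m}. X $$ x * \<Phi> (E x) $$ (i, j))"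
      using step[of "{..<m} \<times> {..<m}"] by simp
    then show ?thesis by (simp add: sum.cartesian_product split_def)
  qed
  then show ?thesis by (intro exI[of _ "\<lambda>a b i j. \<Phi> (E (a, b)) $$ (i, j)"]) blast
qed

text \<open>Common interface for the three maps whose relative entropies enter G: the two channels
  extended by the identity on R, and the partial trace over A.\<close>

definition positive_tp_map :: "nat \<Rightarrow> nat \<Rightarrow> (complex mat \<Rightarrow> complex mat) \<Rightarrow> bool" where
  "positive_tp_map m n F \<longleftrightarrow>
     linear_map_mat m n F \<and> (\<forall>X. psd m X \<longrightarrow> psd n (F X)) \<and> trace_preserving m F"

lemma block_carrier [simp]: "block m X i j \<in> carrier_mat m m"
  by (simp add: block_def)

text \<open>Complete positivity is instantiated at reference dimension \<open>k\<close>, and the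
  trace involves only the diagonal blocks.\<close>

lemma positive_tp_map_apply_snd:
  assumes "quantum_channel m n \<Phi>"
  shows "positive_tp_map (k * m) (k * n) (apply_snd k m n \<Phi>)"
proof -
  have lin: "linear_map_mat m n \<Phi>" and cp: "completely_positive m n \<Phi>" and tp: "trace_preserving m \<Phi>"
    using assms by (auto simp: quantum_channel_def)
  have car: "\<Phi> (block m X i j) \<in> carrier_mat n n" for X i j
    using lin by (simp add: linear_map_mat_def)
  have "linear_map_mat (k * m) (k * n) (apply_snd k m n \<Phi>)"
    unfolding linear_map_mat_def
  proof (intro conjI ballI allI)
    fix X Y :: "complex mat" and c
    assume X: "X \<in> carrier_mat (k * m) (k * m)"
    show "apply_snd k m n \<Phi> X \<in> carrier_mat (k * n) (k * n)" by (simp add: apply_snd_def)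
    have "block m (c \<cdot>\<^sub>m X) i j = c \<cdot>\<^sub>m block m X i j" if "i < k" "j < k" for i j
      using X that by (auto simp: block_def index_less_mult intro!: eq_matI)
    then have "\<Phi> (block m (c \<cdot>\<^sub>m X) i j) = c \<cdot>\<^sub>m \<Phi> (block m X i j)" if "i < k" "j < k" for i j
      using lin that by (simp add: linear_map_mat_def)
    then show "apply_snd k m n \<Phi> (c \<cdot>\<^sub>m X) = c \<cdot>\<^sub>m apply_snd k m n \<Phi> X"
      using carrier_matD[OF car]
      by (intro eq_matI) (auto simp: apply_snd_def less_mult_imp_div_less mod_less_mult)
    assume Y: "Y \<in> carrier_mat (k * m) (k * m)"
    have "block m (X + Y) i j = block m X i j + block m Y i j" if "i < k" "j < k" for i j
      using X Y that by (auto simp: block_def index_less_mult intro!: eq_matI)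
    then have "\<Phi> (block m (X + Y) i j) = \<Phi> (block m X i j) + \<Phi> (block m Y i j)"
      if "i < k" "j < k" for i j
      using lin that by (simp add: linear_map_mat_def)
    then show "apply_snd k m n \<Phi> (X + Y) = apply_snd k m n \<Phi> X + apply_snd k m n \<Phi> Y"
      using carrier_matD[OF car]
      by (intro eq_matI) (auto simp: apply_snd_def less_mult_imp_div_less mod_less_mult)
  qed
  moreover have "trace_preserving (k * m) (apply_snd k m n \<Phi>)"
    unfolding trace_preserving_def
  proof
    fix X :: "complex mat" assume X: "X \<in> carrier_mat (k * m) (k * m)"
    have "mat_trace (apply_snd k m n \<Phi> X) =
        (\<Sum>l<k * n. (\<lambda>i a. \<Phi> (block m X i i) $$ (a, a)) (l div n) (l mod n))"
      by (simp add: mat_trace_def apply_snd_def)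
    also have "\<dots> = (\<Sum>i<k. mat_trace (\<Phi> (block m X i i)))"
      using carrier_matD[OF car]
      by (subst sum_div_mod[of "\<lambda>i a. \<Phi> (block m X i i) $$ (a, a)"]) (simp add: mat_trace_def)
    also have "\<dots> = (\<Sum>i<k. mat_trace (block m X i i))"
      using tp by (simp add: trace_preserving_def)
    also have "\<dots> = (\<Sum>i<k. \<Sum>a<m. X $$ (i * m + a, i * m + a))"
      by (simp add: mat_trace_def block_def)
    also have "\<dots> = (\<Sum>l<k * m. X $$ (l div m * m + l mod m, l div m * m + l mod m))"
      by (rule sum_div_mod[symmetric])
    also have "\<dots> = mat_trace X" using X by (simp add: mat_trace_def)
    finally show "mat_trace (apply_snd k m n \<Phi> X) = mat_trace X" .
  qed
  ultimately show ?thesis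
    using cp by (simp add: positive_tp_map_def completely_positive_def)
qed

text \<open>With \<open>w a\<close> equal to \<open>v\<close> tensored with the a-th basis vector,
  the form of the partial trace at \<open>v\<close> is the sum of the forms of \<open>X\<close> at
  the \<open>w a\<close>.\<close>

lemma ptrace_snd_psd:
  assumes "psd (m * n) X"
  shows "psd m (ptrace_snd m n X)"
  unfolding psd_def
proof (intro conjI ballI)
  have X: "X \<in> carrier_mat (m * n) (m * n)" using assms by (simp add: psd_def)
  show P: "ptrace_snd m n X \<in> carrier_mat m m" by (simp add: ptrace_snd_def)
  fix v :: "complex vec" assume v: "v \<in> carrier_vec m"
  define w where "w a = vec (m * n) (\<lambda>k. if k mod n = a then v $ (k div n) else 0)" for a
  have w: "w a \<in> carrier_vec (m * n)" for a by (simp add: w_def)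
  have Q: "(X *\<^sub>v w a) \<bullet>c w a = (\<Sum>i<m. \<Sum>j<m. X $$ (i * n + a, j * n + a) * v $ j * cnj (v $ i))"
    if a: "a < n" for a
  proof -
    let ?g = "\<lambda>k j c. X $$ (k, j * n + c) * (if c = a then v $ j else 0) * cnj (w a $ k)"
    let ?h = "\<lambda>i b. \<Sum>j<m. X $$ (i * n + b, j * n + a) * v $ j * cnj (if b = a then v $ i else 0)"
    have "(X *\<^sub>v w a) \<bullet>c w a = (\<Sum>k<m * n. \<Sum>l<m * n. ?g k (l div n) (l mod n))"
      unfolding quad_form_sum[OF X w] by (intro sum.cong refl) (simp add: w_def)
    also have "\<dots> = (\<Sum>k<m * n. \<Sum>j<m. \<Sum>c<n. ?g k j c)"
      by (rule sum.cong[OF refl]) (rule sum_div_mod)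
    also have "\<dots> = (\<Sum>k<m * n. \<Sum>j<m. X $$ (k, j * n + a) * v $ j * cnj (w a $ k))"
    proof (intro sum.cong refl)
      fix k j
      have "(\<Sum>c<n. ?g k j c) = (\<Sum>c<n. if c = a then X $$ (k, j * n + a) * v $ j * cnj (w a $ k) else 0)"
        by (intro sum.cong refl) simp
      then show "(\<Sum>c<n. ?g k j c) = X $$ (k, j * n + a) * v $ j * cnj (w a $ k)"
        using a by simp
    qed
    also have "\<dots> = (\<Sum>k<m * n. ?h (k div n) (k mod n))"
      by (intro sum.cong refl) (simp add: w_def)
    also have "\<dots> = (\<Sum>i<m. \<Sum>b<n. ?h i b)"
      by (rule sum_div_mod)
    also have "\<dots> = (\<Sum>i<m. \<Sum>j<m. X $$ (i * n + a, j * n + a) * v $ j * cnj (v $ i))"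
    proof (rule sum.cong[OF refl])
      fix i
      have "(\<Sum>b<n. ?h i b) = (\<Sum>b<n. if b = a then \<Sum>j<m. X $$ (i * n + a, j * n + a) * v $ j * cnj (v $ i) else 0)"
        by (intro sum.cong refl) simp
      then show "(\<Sum>b<n. ?h i b) = (\<Sum>j<m. X $$ (i * n + a, j * n + a) * v $ j * cnj (v $ i))"
        using a by simp
    qed
    finally show ?thesis .
  qed
  have "(ptrace_snd m n X *\<^sub>v v) \<bullet>c v =
      (\<Sum>i<m. \<Sum>j<m. \<Sum>a<n. X $$ (i * n + a, j * n + a) * v $ j * cnj (v $ i))"
    unfolding quad_form_sum[OF P v] by (intro sum.cong refl) (simp add: ptrace_snd_def sum_distrib_right)
  also have "\<dots> = (\<Sum>a<n. \<Sum>i<m. \<Sum>j<m. X $$ (i * n + a, j * n + a) * v $ j * cnj (v $ i))"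
    by (subst (2) sum.swap, subst sum.swap, rule refl)
  also have "\<dots> = (\<Sum>a<n. (X *\<^sub>v w a) \<bullet>c w a)"
    by (intro sum.cong refl) (simp add: Q)
  finally show "(ptrace_snd m n X *\<^sub>v v) \<bullet>c v \<ge> 0"
    using assms w by (auto simp: psd_def less_eq_complex_def intro!: sum_nonneg sum.neutral)
qed

lemma positive_tp_map_ptrace_snd: "positive_tp_map (m * n) m (ptrace_snd m n)"
proof -
  have "linear_map_mat (m * n) m (ptrace_snd m n)"
    unfolding linear_map_mat_def
    by (auto simp: ptrace_snd_def index_less_mult sum.distrib sum_distrib_left intro!: eq_matI)
  moreover have "trace_preserving (m * n) (ptrace_snd m n)"
    unfolding trace_preserving_def
  proof
    fix X :: "complex mat" assume X: "X \<in> carrier_mat (m * n) (m * n)"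
    have "mat_trace (ptrace_snd m n X) = (\<Sum>i<m. \<Sum>a<n. X $$ (i * n + a, i * n + a))"
      by (simp add: mat_trace_def ptrace_snd_def)
    also have "\<dots> = (\<Sum>l<m * n. X $$ (l div n * n + l mod n, l div n * n + l mod n))"
      by (rule sum_div_mod[symmetric])
    also have "\<dots> = mat_trace X" using X by (simp add: mat_trace_def)
    finally show "mat_trace (ptrace_snd m n X) = mat_trace X" .
  qed
  ultimately show ?thesis by (simp add: positive_tp_map_def ptrace_snd_psd)
qed

lemma linear_map_mat_diff:
  assumes lin: "linear_map_mat m n F" and A: "A \<in> carrier_mat m m" and B: "B \<in> carrier_mat m m"
  shows "F (B - c \<cdot>\<^sub>m A) = F B - c \<cdot>\<^sub>m F A"
proof -
  have FA: "F A \<in> carrier_mat n n" "F B \<in> carrier_mat n n"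
    using lin A B by (auto simp: linear_map_mat_def)
  have "B - c \<cdot>\<^sub>m A = B + (- c) \<cdot>\<^sub>m A"
    using A B by (intro eq_matI) auto
  then have "F (B - c \<cdot>\<^sub>m A) = F B + (- c) \<cdot>\<^sub>m F A"
    using lin A B by (simp add: linear_map_mat_def)
  also have "\<dots> = F B - c \<cdot>\<^sub>m F A"
    using FA by (intro eq_matI) auto
  finally show ?thesis .
qed

lemma linear_map_mat_mixture:
  assumes lin: "linear_map_mat m n F" and \<tau>: "\<And>u. u < dU \<Longrightarrow> \<tau> u \<in> carrier_mat m m"
  shows "F (mixture dU m p \<tau>) = mixture dU n p (\<lambda>u. F (\<tau> u))"
proof -
  from linear_map_mat_kernel[OF lin] obtain K where
    K: "\<And>X i j. X \<in> carrier_mat m m \<Longrightarrow> i < n \<Longrightarrow> j < n \<Longrightarrow>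
      F X $$ (i, j) = (\<Sum>a<m. \<Sum>b<m. X $$ (a, b) * K a b i j)" by blast
  have F: "F (mixture dU m p \<tau>) \<in> carrier_mat n n"
    using lin by (simp add: linear_map_mat_def)
  show ?thesis
  proof (rule eq_matI)
    fix i j assume "i < dim_row (mixture dU n p (\<lambda>u. F (\<tau> u)))" "j < dim_col (mixture dU n p (\<lambda>u. F (\<tau> u)))"
    then have ij: "i < n" "j < n" by (auto simp: mixture_def)
    have "F (mixture dU m p \<tau>) $$ (i, j) =
        (\<Sum>a<m. \<Sum>b<m. \<Sum>u<dU. of_real (p u) * (\<tau> u $$ (a, b) * K a b i j))"
      unfolding K[OF mixture_carrier ij]
      by (intro sum.cong refl) (simp add: mixture_def sum_distrib_right mult.assoc)
    also have "\<dots> = (\<Sum>u<dU. \<Sum>a<m. \<Sum>b<m. of_real (p u) * (\<tau> u $$ (a, b) * K a b i j))"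
      by (subst (2) sum.swap, subst sum.swap, rule refl)
    also have "\<dots> = mixture dU n p (\<lambda>u. F (\<tau> u)) $$ (i, j)"
      using ij by (simp add: mixture_def K[OF \<tau>] sum_distrib_left)
    finally show "F (mixture dU m p \<tau>) $$ (i, j) = mixture dU n p (\<lambda>u. F (\<tau> u)) $$ (i, j)" .
  qed (use F in \<open>auto simp: mixture_def\<close>)
qed

context
  fixes m n F
  assumes F: "positive_tp_map m n F"
begin

lemma positive_tp_map_psd: "psd m X \<Longrightarrow> psd n (F X)"
  using F by (simp add: positive_tp_map_def)

lemma positive_tp_map_state: "quantum_state m X \<Longrightarrow> quantum_state n (F X)"
  using F by (auto simp: positive_tp_map_def quantum_state_def trace_preserving_def psd_def)

lemma positive_tp_map_linear: "linear_map_mat m n F"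
  using F by (simp add: positive_tp_map_def)

text \<open>Domination passes through the map: the image of \<open>B\<close> - c \<open>A\<close> is
  positive semidefinite and equals \<open>F B\<close> - c \<open>F A\<close>.\<close>

lemma positive_tp_map_supp:
  assumes A: "psd m A" and B: "psd m B" and sub: "supp A \<subseteq> supp B"
  shows "supp (F A) \<subseteq> supp (F B)"
proof -
  have "dominated m A B" using dominated_iff_supp[OF A B] sub by blast
  then obtain c where c: "c > 0" "psd m (B - complex_of_real c \<cdot>\<^sub>m A)"
    unfolding dominated_def by blast
  have "F (B - complex_of_real c \<cdot>\<^sub>m A) = F B - complex_of_real c \<cdot>\<^sub>m F A"
    by (rule linear_map_mat_diff[OF positive_tp_map_linear psd_carrier[OF A] psd_carrier[OF B]])
  then have "dominated n (F A) (F B)"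
    using positive_tp_map_psd[OF c(2)] c(1) unfolding dominated_def by auto
  then show ?thesis
    using dominated_iff_supp[OF positive_tp_map_psd[OF A] positive_tp_map_psd[OF B]] by blast
qed

text \<open>On the line \<sigma> - t X the images differ by -t \<open>F X\<close>, so their squared
  Hilbert-Schmidt distance is proportional to t^2. The constant is chosen before \<tau> and t, which
  makes the bound usable in a limit.\<close>

lemma positive_tp_map_rel_entropy_second_order:
  assumes \<sigma>: "quantum_state m \<sigma>" and X: "X \<in> carrier_mat m m"
  shows "\<exists>C. \<forall>\<tau> t. quantum_state m \<tau> \<longrightarrow> supp \<tau> \<subseteq> supp \<sigma> \<longrightarrow> \<tau> = \<sigma> - complex_of_real t \<cdot>\<^sub>m X \<longrightarrow>
    0 \<le> rel_entropy_real (F \<tau>) (F \<sigma>) \<and> rel_entropy_real (F \<tau>) (F \<sigma>) \<le> C * t\<^sup>2"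
proof -
  have s: "psd m \<sigma>" "\<sigma> \<in> carrier_mat m m" using \<sigma> by (auto simp: quantum_state_def psd_def)
  have F\<sigma>: "F \<sigma> \<in> carrier_mat n n" and FX: "F X \<in> carrier_mat n n"
    using positive_tp_map_linear s X by (auto simp: linear_map_mat_def)
  from rel_entropy_real_bounds[OF positive_tp_map_psd[OF s(1)]] obtain C where
    C: "\<And>A. psd n A \<Longrightarrow> mat_trace A = mat_trace (F \<sigma>) \<Longrightarrow> supp A \<subseteq> supp (F \<sigma>) \<Longrightarrow>
      0 \<le> rel_entropy_real A (F \<sigma>) \<and>
      rel_entropy_real A (F \<sigma>) \<le> C * Re (mat_trace ((A - F \<sigma>) * (A - F \<sigma>)))" by blast
  have "0 \<le> rel_entropy_real (F \<tau>) (F \<sigma>) \<and>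
      rel_entropy_real (F \<tau>) (F \<sigma>) \<le> C * Re (mat_trace (F X * F X)) * t\<^sup>2"
    if \<tau>: "quantum_state m \<tau>" and sub: "supp \<tau> \<subseteq> supp \<sigma>"
      and eq: "\<tau> = \<sigma> - complex_of_real t \<cdot>\<^sub>m X" for \<tau> t
  proof -
    have t: "psd m \<tau>" using \<tau> by (simp add: quantum_state_def)
    have "F \<tau> = F \<sigma> - complex_of_real t \<cdot>\<^sub>m F X"
      unfolding eq by (rule linear_map_mat_diff[OF positive_tp_map_linear X s(2)])
    then have diff: "F \<tau> - F \<sigma> = complex_of_real (- t) \<cdot>\<^sub>m F X"
      using F\<sigma> FX by (auto intro!: eq_matI)
    have tX: "complex_of_real (- t) \<cdot>\<^sub>m F X \<in> carrier_mat n n" using FX by simp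
    have "mat_trace ((F \<tau> - F \<sigma>) * (F \<tau> - F \<sigma>)) = of_real (t\<^sup>2) * mat_trace (F X * F X)"
      unfolding diff mat_trace_mult_sum[OF tX tX] mat_trace_mult_sum[OF FX FX]
      using FX by (simp add: sum_distrib_left power2_eq_square mult_ac)
    moreover have "mat_trace (F \<tau>) = mat_trace (F \<sigma>)"
      using positive_tp_map_state[OF \<tau>] positive_tp_map_state[OF \<sigma>] by (simp add: quantum_state_def)
    ultimately show ?thesis
      using C[OF positive_tp_map_psd[OF t] _ positive_tp_map_supp[OF t s(1) sub]]
      by (simp add: mult_ac)
  qed
  then show ?thesis by blast
qed

end

section \<open>Channels and partial traces on classical-quantum states\<close>

text \<open>Index arithmetic for associativity: a flat index of U R A is split once as (U R) A and
  once as U (R A).\<close>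

lemma mult_add_div_mult: "a < m \<Longrightarrow> (l * m + a) div (k * m) = l div (k :: nat)"
  using div_mult2_eq[of "l * m + a" m k] by (simp add: mult.commute[of k m])

lemma mult_add_mod_mult: "a < m \<Longrightarrow> (l * m + a) mod (k * m) = (l mod k) * m + (a :: nat)"
  using mod_mult2_eq[of "l * m + a" m k] by (simp add: mult.commute[of k m] mult.commute[of m "l mod k"])

text \<open>The map acts on A in the reading (U R) A, while the state has its blocks in the reading
  U (R A). Each block over U R is a linear combination of blocks of the \<open>\<tau> u\<close>, so
  linearity suffices.\<close>

lemma apply_snd_cq_mat:
  assumes onb: "orthonormal_basis dU e" and lin: "linear_map_mat m n \<Phi>"
    and \<tau>: "\<And>u. u < dU \<Longrightarrow> \<tau> u \<in> carrier_mat (k * m) (k * m)"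
  shows "apply_snd (dU * k) m n \<Phi> (cq_mat dU (k * m) e p \<tau>) =
    cq_mat dU (k * n) e p (\<lambda>u. apply_snd k m n \<Phi> (\<tau> u))"
proof (rule eq_matI)
  from linear_map_mat_kernel[OF lin] obtain K where
    K: "\<And>X i j. X \<in> carrier_mat m m \<Longrightarrow> i < n \<Longrightarrow> j < n \<Longrightarrow>
      \<Phi> X $$ (i, j) = (\<Sum>a<m. \<Sum>b<m. X $$ (a, b) * K a b i j)" by blast
  fix i j
  assume "i < dim_row (cq_mat dU (k * n) e p (\<lambda>u. apply_snd k m n \<Phi> (\<tau> u)))"
    "j < dim_col (cq_mat dU (k * n) e p (\<lambda>u. apply_snd k m n \<Phi> (\<tau> u)))"
  then have ij: "i < dU * (k * n)" "j < dU * (k * n)" by (auto simp: cq_mat_def)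
  define i1 i2 where "i1 = i div n" and "i2 = i mod n"
  define j1 j2 where "j1 = j div n" and "j2 = j mod n"
  have ij1: "i1 < dU * k" "j1 < dU * k" and ij2: "i2 < n" "j2 < n"
    using ij by (auto simp: i1_def j1_def i2_def j2_def less_mult_imp_div_less mod_less_mult mult.assoc[symmetric])
  then have kp: "i1 mod k < k" "j1 mod k < k" by (auto simp: mod_less_mult)
  let ?c = "\<lambda>u. of_real (p u) * (e u $ (i1 div k) * cnj (e u $ (j1 div k)))"
  have split': "l div (k * n) = l div n div k" "l mod (k * n) div n = l div n mod k"
      "l mod (k * n) mod n = l mod n" if "n > 0" for l
    using that by (simp_all add: div_mult2_eq mod_mult2_eq mult.commute[of k n])
  have blk: "block m (cq_mat dU (k * m) e p \<tau>) i1 j1 $$ (a, b) =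
      (\<Sum>u<dU. ?c u * block m (\<tau> u) (i1 mod k) (j1 mod k) $$ (a, b))" if ab: "a < m" "b < m" for a b
    using ab ij1 index_less_mult[of i1 "dU * k" a m] index_less_mult[of j1 "dU * k" b m]
    by (simp add: block_def cq_mat_index[OF onb \<tau>] mult_add_div_mult mult_add_mod_mult mult.assoc)
  have "apply_snd (dU * k) m n \<Phi> (cq_mat dU (k * m) e p \<tau>) $$ (i, j) =
      \<Phi> (block m (cq_mat dU (k * m) e p \<tau>) i1 j1) $$ (i2, j2)"
    using ij by (simp add: apply_snd_def i1_def j1_def i2_def j2_def mult.assoc)
  also have "\<dots> = (\<Sum>a<m. \<Sum>b<m. \<Sum>u<dU. ?c u * (block m (\<tau> u) (i1 mod k) (j1 mod k) $$ (a, b) * K a b i2 j2))"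
    unfolding K[OF block_carrier ij2]
    by (intro sum.cong refl) (simp add: blk sum_distrib_right mult.assoc)
  also have "\<dots> = (\<Sum>u<dU. \<Sum>a<m. \<Sum>b<m. ?c u * (block m (\<tau> u) (i1 mod k) (j1 mod k) $$ (a, b) * K a b i2 j2))"
    by (subst (2) sum.swap, subst sum.swap, rule refl)
  also have "\<dots> = (\<Sum>u<dU. ?c u * \<Phi> (block m (\<tau> u) (i1 mod k) (j1 mod k)) $$ (i2, j2))"
    by (simp add: K[OF block_carrier ij2] sum_distrib_left)
  also have "\<dots> = cq_mat dU (k * n) e p (\<lambda>u. apply_snd k m n \<Phi> (\<tau> u)) $$ (i, j)"
    using ij ij2 mod_less_mult[OF ij(1)] mod_less_mult[OF ij(2)]
    by (subst cq_mat_index[OF onb])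
      (simp_all add: apply_snd_def split' i1_def j1_def i2_def j2_def)
  finally show "apply_snd (dU * k) m n \<Phi> (cq_mat dU (k * m) e p \<tau>) $$ (i, j) =
      cq_mat dU (k * n) e p (\<lambda>u. apply_snd k m n \<Phi> (\<tau> u)) $$ (i, j)" .
qed (simp_all add: apply_snd_def cq_mat_def mult.assoc)

lemma ptrace_snd_cq_mat:
  assumes onb: "orthonormal_basis dU e"
    and \<tau>: "\<And>u. u < dU \<Longrightarrow> \<tau> u \<in> carrier_mat (k * n) (k * n)"
  shows "ptrace_snd (dU * k) n (cq_mat dU (k * n) e p \<tau>) =
    cq_mat dU k e p (\<lambda>u. ptrace_snd k n (\<tau> u))"
proof (rule eq_matI)
  fix i j
  assume "i < dim_row (cq_mat dU k e p (\<lambda>u. ptrace_snd k n (\<tau> u)))"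
    "j < dim_col (cq_mat dU k e p (\<lambda>u. ptrace_snd k n (\<tau> u)))"
  then have ij: "i < dU * k" "j < dU * k" by (auto simp: cq_mat_def)
  let ?c = "\<lambda>u. of_real (p u) * (e u $ (i div k) * cnj (e u $ (j div k)))"
  have "ptrace_snd (dU * k) n (cq_mat dU (k * n) e p \<tau>) $$ (i, j) =
      (\<Sum>a<n. \<Sum>u<dU. ?c u * \<tau> u $$ (i mod k * n + a, j mod k * n + a))"
    using ij index_less_mult[of i "dU * k" _ n] index_less_mult[of j "dU * k" _ n]
    by (simp add: ptrace_snd_def cq_mat_index[OF onb \<tau>] mult_add_div_mult mult_add_mod_mult mult.assoc)
  also have "\<dots> = (\<Sum>u<dU. ?c u * (\<Sum>a<n. \<tau> u $$ (i mod k * n + a, j mod k * n + a)))"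
    by (subst sum.swap) (simp add: sum_distrib_left)
  also have "\<dots> = cq_mat dU k e p (\<lambda>u. ptrace_snd k n (\<tau> u)) $$ (i, j)"
    using ij mod_less_mult[OF ij(1)] mod_less_mult[OF ij(2)]
    by (subst cq_mat_index[OF onb]) (simp_all add: ptrace_snd_def)
  finally show "ptrace_snd (dU * k) n (cq_mat dU (k * n) e p \<tau>) $$ (i, j) =
      cq_mat dU k e p (\<lambda>u. ptrace_snd k n (\<tau> u)) $$ (i, j)" .
qed (simp_all add: ptrace_snd_def cq_mat_def)

text \<open>Trace preservation, block by block. Hence the marginal on R is the same before and after
  either channel, which is why one and the same R-term occurs on both sides of (iii).\<close>

lemma ptrace_snd_apply_snd:
  assumes ch: "quantum_channel m n \<Phi>" and X: "X \<in> carrier_mat (k * m) (k * m)"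
  shows "ptrace_snd k n (apply_snd k m n \<Phi> X) = ptrace_snd k m X"
proof (rule eq_matI)
  fix i j assume "i < dim_row (ptrace_snd k m X)" "j < dim_col (ptrace_snd k m X)"
  then have ij: "i < k" "j < k" by (auto simp: ptrace_snd_def)
  have car: "\<Phi> (block m X i j) \<in> carrier_mat n n"
    using ch by (simp add: quantum_channel_def linear_map_mat_def)
  have "ptrace_snd k n (apply_snd k m n \<Phi> X) $$ (i, j) = mat_trace (\<Phi> (block m X i j))"
    using ij car by (auto simp: ptrace_snd_def apply_snd_def mat_trace_def index_less_mult)
  also have "\<dots> = mat_trace (block m X i j)"
    using ch by (simp add: quantum_channel_def trace_preserving_def)
  also have "\<dots> = ptrace_snd k m X $$ (i, j)"
    using ij by (simp add: mat_trace_def block_def ptrace_snd_def)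
  finally show "ptrace_snd k n (apply_snd k m n \<Phi> X) $$ (i, j) = ptrace_snd k m X $$ (i, j)" .
qed (simp_all add: ptrace_snd_def)

text \<open>I(U:RB) and I(U:R) are Holevo quantities of two images of one ensemble, and linearity
  sends its mean \<sigma> to the two reference states.\<close>

lemma cond_mutual_info_cq_mat:
  assumes onb: "orthonormal_basis dU e" and p: "\<And>u. u < dU \<Longrightarrow> p u \<ge> 0"
    and \<tau>: "\<And>u. u < dU \<Longrightarrow> quantum_state (k * m) (\<tau> u)"
    and ch: "quantum_channel m n \<Phi>" and mix: "mixture dU (k * m) p \<tau> = \<sigma>"
  shows "cond_mutual_info dU k n (apply_snd (dU * k) m n \<Phi> (cq_mat dU (k * m) e p \<tau>)) =
    ereal (\<Sum>u<dU. p u * (rel_entropy_real (apply_snd k m n \<Phi> (\<tau> u)) (apply_snd k m n \<Phi> \<sigma>)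
      - rel_entropy_real (ptrace_snd k m (\<tau> u)) (ptrace_snd k m \<sigma>)))"
proof -
  note F = positive_tp_map_apply_snd[OF ch, of k] and P = positive_tp_map_ptrace_snd[of k m]
  have lin: "linear_map_mat m n \<Phi>" using ch by (simp add: quantum_channel_def)
  have c: "\<tau> u \<in> carrier_mat (k * m) (k * m)" if "u < dU" for u
    using \<tau>[OF that] by (simp add: quantum_state_def psd_def)
  have Fc: "apply_snd k m n \<Phi> (\<tau> u) \<in> carrier_mat (k * n) (k * n)" for u
    by (simp add: apply_snd_def)
  have F\<sigma>: "mixture dU (k * n) p (\<lambda>u. apply_snd k m n \<Phi> (\<tau> u)) = apply_snd k m n \<Phi> \<sigma>"
    unfolding mix[symmetric] by (rule linear_map_mat_mixture[symmetric, OF positive_tp_map_linear[OF F] c])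
  have P\<sigma>: "mixture dU k p (\<lambda>u. ptrace_snd k m (\<tau> u)) = ptrace_snd k m \<sigma>"
    unfolding mix[symmetric] by (rule linear_map_mat_mixture[symmetric, OF positive_tp_map_linear[OF P] c])
  have 1: "apply_snd (dU * k) m n \<Phi> (cq_mat dU (k * m) e p \<tau>) =
      cq_mat dU (k * n) e p (\<lambda>u. apply_snd k m n \<Phi> (\<tau> u))"
    by (rule apply_snd_cq_mat[OF onb lin c])
  have 2: "ptrace_snd (dU * k) n (cq_mat dU (k * n) e p (\<lambda>u. apply_snd k m n \<Phi> (\<tau> u))) =
      cq_mat dU k e p (\<lambda>u. ptrace_snd k n (apply_snd k m n \<Phi> (\<tau> u)))"
    by (rule ptrace_snd_cq_mat[OF onb Fc])
  have 3: "cq_mat dU k e p (\<lambda>u. ptrace_snd k n (apply_snd k m n \<Phi> (\<tau> u))) =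
      cq_mat dU k e p (\<lambda>u. ptrace_snd k m (\<tau> u))"
    unfolding cq_mat_def using c by (intro arg_cong[of _ _ "mat _ _"] ext sum.cong refl)
      (simp add: ptrace_snd_apply_snd[OF ch])
  have 4: "mutual_info dU (k * n) (cq_mat dU (k * n) e p (\<lambda>u. apply_snd k m n \<Phi> (\<tau> u))) =
      ereal (\<Sum>u<dU. p u * rel_entropy_real (apply_snd k m n \<Phi> (\<tau> u)) (apply_snd k m n \<Phi> \<sigma>))"
    unfolding F\<sigma>[symmetric] by (rule mutual_info_cq_mat[OF onb p positive_tp_map_state[OF F \<tau>]])
  have 5: "mutual_info dU k (cq_mat dU k e p (\<lambda>u. ptrace_snd k m (\<tau> u))) =
      ereal (\<Sum>u<dU. p u * rel_entropy_real (ptrace_snd k m (\<tau> u)) (ptrace_snd k m \<sigma>))"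
    unfolding P\<sigma>[symmetric] by (rule mutual_info_cq_mat[OF onb p positive_tp_map_state[OF P \<tau>]])
  show ?thesis
    unfolding cond_mutual_info_def 1 2 3 4 5 by (simp add: sum_subtractf right_diff_distrib)
qed

section \<open>The equivalence\<close>

lemma cq_state_iff:
  "cq_state dU n \<rho> \<longleftrightarrow> (\<exists>e p \<tau>. orthonormal_basis dU e \<and> (\<forall>u<dU. p u \<ge> 0) \<and> (\<Sum>u<dU. p u) = 1 \<and>
     (\<forall>u<dU. quantum_state n (\<tau> u)) \<and> \<rho> = cq_mat dU n e p \<tau>)"
  unfolding cq_state_def cq_mat_def ..

lemma quantum_state_carrier: "quantum_state n A \<Longrightarrow> A \<in> carrier_mat n n"
  by (simp add: quantum_state_def psd_def)

text \<open>Solve \<sigma> = l \<rho> + (1 - l) \<tau> for \<tau>, and write the result as a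
  displacement from \<sigma> along \<rho> - \<sigma> to fit the second-order estimate. Positivity
  follows from \<sigma> - l \<rho> = (\<sigma> - c \<rho>) + (c - l) \<rho>.\<close>

lemma state_decomposition:
  assumes \<sigma>: "quantum_state n \<sigma>" and \<rho>: "quantum_state n \<rho>"
    and ps: "psd n (\<sigma> - complex_of_real c \<cdot>\<^sub>m \<rho>)" and l: "0 < l" "l \<le> c" "l < 1"
  defines "\<tau> \<equiv> \<sigma> - complex_of_real (l / (1 - l)) \<cdot>\<^sub>m (\<rho> - \<sigma>)"
  shows "quantum_state n \<tau>"
    and "mixture 2 n (\<lambda>u. if u = 0 then l else 1 - l) (\<lambda>u. if u = 0 then \<rho> else \<tau>) = \<sigma>"
proof -
  note s = quantum_state_carrier[OF \<sigma>] and r = quantum_state_carrier[OF \<rho>]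
  have \<tau>: "\<tau> \<in> carrier_mat n n"
    unfolding \<tau>_def using s r by (intro minus_carrier_mat smult_carrier_mat)
  have l1: "complex_of_real (1 - l) \<noteq> 0" using l by (simp del: of_real_diff)
  have idx: "\<tau> $$ (i, j) = (\<sigma> $$ (i, j) - of_real l * \<rho> $$ (i, j)) / of_real (1 - l)"
    if "i < n" "j < n" for i j
    using that s r l1 by (simp add: \<tau>_def field_simps)
  show "mixture 2 n (\<lambda>u. if u = 0 then l else 1 - l) (\<lambda>u. if u = 0 then \<rho> else \<tau>) = \<sigma>"
    using s l1 by (intro eq_matI) (auto simp: mixture_def idx numeral_2_eq_2 simp del: of_real_diff)
  have "mat_trace \<tau> = (mat_trace \<sigma> - of_real l * mat_trace \<rho>) / of_real (1 - l)"
    using s r \<tau> by (simp add: mat_trace_def idx sum_subtractf sum_distrib_left sum_divide_distrib[symmetric] del: of_real_diff)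
  then have tr: "mat_trace \<tau> = 1"
    using \<sigma> \<rho> l1 by (simp add: quantum_state_def)
  have "psd n \<tau>" unfolding psd_def
  proof (intro conjI ballI \<tau>)
    fix v :: "complex vec" assume v: "v \<in> carrier_vec n"
    have "(\<tau> *\<^sub>v v) \<bullet>c v = (((\<sigma> *\<^sub>v v) \<bullet>c v) - of_real l * ((\<rho> *\<^sub>v v) \<bullet>c v)) / of_real (1 - l)"
      unfolding quad_form_sum[OF \<tau> v] quad_form_sum[OF s v] quad_form_sum[OF r v]
      by (simp add: idx sum_subtractf sum_distrib_left sum_divide_distrib[symmetric] left_diff_distrib
        diff_divide_distrib mult.assoc del: of_real_diff)
    also have "\<dots> = of_real (1 / (1 - l)) * (((\<sigma> - complex_of_real c \<cdot>\<^sub>m \<rho>) *\<^sub>v v) \<bullet>c v +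
        of_real (c - l) * ((\<rho> *\<^sub>v v) \<bullet>c v))"
      unfolding quad_form_minus[OF r s v] using l1 by (simp add: field_simps)
    finally show "(\<tau> *\<^sub>v v) \<bullet>c v \<ge> 0"
      using ps \<rho> v l by (simp add: psd_def quantum_state_def less_eq_complex_def)
  qed
  with tr show "quantum_state n \<tau>" by (simp add: quantum_state_def)
qed

lemma orthonormal_basis_unit_vec: "orthonormal_basis n (unit_vec n)"
  by (auto simp: orthonormal_basis_def unit_vec_def scalar_prod_def if_distrib[of "\<lambda>x. _ * x"]
    if_distrib[of cnj] cong: if_cong)

theorem mainTheorem1:
  fixes dR dA dB dB' :: nat
    and M N :: "complex mat \<Rightarrow> complex mat"
    and \<sigma> :: "complex mat"
    and \<eta> :: real
  assumes "quantum_channel dA dB M"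
    and "quantum_channel dA dB' N"
    and "quantum_state (dR * dA) \<sigma>"
    and "\<eta> \<ge> 0"
  shows "((\<forall>\<rho>. cq_state 2 (dR * dA) \<rho> \<and> ptrace_fst 2 (dR * dA) \<rho> = \<sigma> \<longrightarrow>
        ereal \<eta> * cond_mutual_info 2 dR dB (apply_snd (2 * dR) dA dB M \<rho>)
          \<ge> cond_mutual_info 2 dR dB' (apply_snd (2 * dR) dA dB' N \<rho>))
    \<longleftrightarrow>
     (\<forall>dU \<rho>. cq_state dU (dR * dA) \<rho> \<and> ptrace_fst dU (dR * dA) \<rho> = \<sigma> \<longrightarrow>
        ereal \<eta> * cond_mutual_info dU dR dB (apply_snd (dU * dR) dA dB M \<rho>)
          \<ge> cond_mutual_info dU dR dB' (apply_snd (dU * dR) dA dB' N \<rho>)))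
   \<and>
    ((\<forall>dU \<rho>. cq_state dU (dR * dA) \<rho> \<and> ptrace_fst dU (dR * dA) \<rho> = \<sigma> \<longrightarrow>
        ereal \<eta> * cond_mutual_info dU dR dB (apply_snd (dU * dR) dA dB M \<rho>)
          \<ge> cond_mutual_info dU dR dB' (apply_snd (dU * dR) dA dB' N \<rho>))
    \<longleftrightarrow>
     (\<forall>\<rho>. quantum_state (dR * dA) \<rho> \<and> supp \<rho> \<subseteq> supp \<sigma> \<longrightarrow>
            ereal \<eta> * (rel_entropy (apply_snd dR dA dB M \<rho>) (apply_snd dR dA dB M \<sigma>)
                        - rel_entropy (ptrace_snd dR dA \<rho>) (ptrace_snd dR dA \<sigma>))
              \<ge> rel_entropy (apply_snd dR dA dB' N \<rho>) (apply_snd dR dA dB' N \<sigma>)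
                  - rel_entropy (ptrace_snd dR dA \<rho>) (ptrace_snd dR dA \<sigma>)))"
proof -
  define n where "n = dR * dA"
  note chM = assms(1) and chN = assms(2) and \<sigma> = assms(3)[folded n_def] and \<eta> = assms(4)
  note FM = positive_tp_map_apply_snd[OF chM, of dR, folded n_def]
    and FN = positive_tp_map_apply_snd[OF chN, of dR, folded n_def]
    and FR = positive_tp_map_ptrace_snd[of dR dA, folded n_def]
  have \<sigma>p: "psd n \<sigma>" and \<sigma>c: "\<sigma> \<in> carrier_mat n n"
    using \<sigma> by (auto simp: quantum_state_def psd_def)
  define DM where "DM \<rho> = rel_entropy_real (apply_snd dR dA dB M \<rho>) (apply_snd dR dA dB M \<sigma>)" for \<rho>
  define DN where "DN \<rho> = rel_entropy_real (apply_snd dR dA dB' N \<rho>) (apply_snd dR dA dB' N \<sigma>)" for \<rho>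
  define DR where "DR \<rho> = rel_entropy_real (ptrace_snd dR dA \<rho>) (ptrace_snd dR dA \<sigma>)" for \<rho>
  define G where "G \<rho> = \<eta> * (DM \<rho> - DR \<rho>) - (DN \<rho> - DR \<rho>)" for \<rho>

  \<comment> \<open>All three maps preserve the inclusion of supports, so no relative entropy here
    is infinite and the comparison takes place in the reals.\<close>
  have iii: "ereal \<eta> * (rel_entropy (apply_snd dR dA dB M \<rho>) (apply_snd dR dA dB M \<sigma>)
          - rel_entropy (ptrace_snd dR dA \<rho>) (ptrace_snd dR dA \<sigma>))
        \<ge> rel_entropy (apply_snd dR dA dB' N \<rho>) (apply_snd dR dA dB' N \<sigma>)
          - rel_entropy (ptrace_snd dR dA \<rho>) (ptrace_snd dR dA \<sigma>) \<longleftrightarrow> G \<rho> \<ge> 0"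
    if "quantum_state n \<rho>" "supp \<rho> \<subseteq> supp \<sigma>" for \<rho>
  proof -
    have "psd n \<rho>" using that by (simp add: quantum_state_def)
    note sub = positive_tp_map_supp[OF _ this \<sigma>p that(2)]
    show ?thesis
      by (simp add: rel_entropy_eq_real[OF sub[OF FM]] rel_entropy_eq_real[OF sub[OF FN]]
        rel_entropy_eq_real[OF sub[OF FR]] G_def DM_def DN_def DR_def)
  qed

  \<comment> \<open>Both informations are finite averages with the same weights \<open>p u\<close>,
    so \<eta> times the first minus the second is the average of \<open>G\<close>.\<close>
  have cq: "ereal \<eta> * cond_mutual_info dU dR dB (apply_snd (dU * dR) dA dB M (cq_mat dU n e p \<tau>))
        \<ge> cond_mutual_info dU dR dB' (apply_snd (dU * dR) dA dB' N (cq_mat dU n e p \<tau>))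
      \<longleftrightarrow> (\<Sum>u<dU. p u * G (\<tau> u)) \<ge> 0"
    if "orthonormal_basis dU e" "\<And>u. u < dU \<Longrightarrow> p u \<ge> 0" "\<And>u. u < dU \<Longrightarrow> quantum_state n (\<tau> u)"
      "mixture dU n p \<tau> = \<sigma>" for dU e p \<tau>
  proof -
    note cm = cond_mutual_info_cq_mat[OF that(1,2) that(3)[unfolded n_def] _ that(4)[unfolded n_def], folded n_def]
    have 1: "cond_mutual_info dU dR dB (apply_snd (dU * dR) dA dB M (cq_mat dU n e p \<tau>)) =
        ereal (\<Sum>u<dU. p u * (DM (\<tau> u) - DR (\<tau> u)))"
      unfolding DM_def DR_def by (rule cm[OF _ _ chM])
    have 2: "cond_mutual_info dU dR dB' (apply_snd (dU * dR) dA dB' N (cq_mat dU n e p \<tau>)) =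
        ereal (\<Sum>u<dU. p u * (DN (\<tau> u) - DR (\<tau> u)))"
      unfolding DN_def DR_def by (rule cm[OF _ _ chN])
    have "(\<Sum>u<dU. p u * G (\<tau> u)) =
        \<eta> * (\<Sum>u<dU. p u * (DM (\<tau> u) - DR (\<tau> u))) - (\<Sum>u<dU. p u * (DN (\<tau> u) - DR (\<tau> u)))"
      by (simp add: G_def sum_distrib_left sum_subtractf[symmetric] algebra_simps)
    then show ?thesis unfolding 1 2 by simp
  qed

  let ?I = "\<forall>\<rho>. cq_state 2 n \<rho> \<and> ptrace_fst 2 n \<rho> = \<sigma> \<longrightarrow>
        ereal \<eta> * cond_mutual_info 2 dR dB (apply_snd (2 * dR) dA dB M \<rho>)
          \<ge> cond_mutual_info 2 dR dB' (apply_snd (2 * dR) dA dB' N \<rho>)"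
  let ?II = "\<forall>dU \<rho>. cq_state dU n \<rho> \<and> ptrace_fst dU n \<rho> = \<sigma> \<longrightarrow>
        ereal \<eta> * cond_mutual_info dU dR dB (apply_snd (dU * dR) dA dB M \<rho>)
          \<ge> cond_mutual_info dU dR dB' (apply_snd (dU * dR) dA dB' N \<rho>)"
  let ?III = "\<forall>\<rho>. quantum_state n \<rho> \<and> supp \<rho> \<subseteq> supp \<sigma> \<longrightarrow> G \<rho> \<ge> 0"

  have "?II" if III: "?III"
  proof (intro allI impI, elim conjE)
    fix dU \<rho> assume "cq_state dU n \<rho>" and marg: "ptrace_fst dU n \<rho> = \<sigma>"
    then obtain e p \<tau> where onb: "orthonormal_basis dU e" and p: "\<And>u. u < dU \<Longrightarrow> p u \<ge> 0"
      and \<tau>: "\<And>u. u < dU \<Longrightarrow> quantum_state n (\<tau> u)" and \<rho>: "\<rho> = cq_mat dU n e p \<tau>"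
      unfolding cq_state_iff by blast
    have mix: "mixture dU n p \<tau> = \<sigma>"
      using ptrace_fst_cq_mat[OF onb quantum_state_carrier[OF \<tau>]] marg \<rho> by simp
    \<comment> \<open>A member of weight zero need not be supported in \<open>supp \<sigma>\<close>,
      so (iii) may say nothing about it; its term is 0.\<close>
    have "p u * G (\<tau> u) \<ge> 0" if u: "u < dU" for u
    proof (cases "p u = 0")
      case False
      then have "p u > 0" using p[OF u] by simp
      moreover have ps: "psd n (\<tau> u)" if "u < dU" for u
        using \<tau>[OF that] by (simp add: quantum_state_def)
      ultimately have "supp (\<tau> u) \<subseteq> supp (mixture dU n p \<tau>)"
        using p u by (intro supp_subset_mixture) auto
      then show ?thesis using III \<tau>[OF u] p[OF u] by (simp add: mix)
    qed simp
    then have "(\<Sum>u<dU. p u * G (\<tau> u)) \<ge> 0" by (intro sum_nonneg) simp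
    then show "ereal \<eta> * cond_mutual_info dU dR dB (apply_snd (dU * dR) dA dB M \<rho>)
          \<ge> cond_mutual_info dU dR dB' (apply_snd (dU * dR) dA dB' N \<rho>)"
      unfolding \<rho> using cq[OF onb p \<tau> mix] by simp
  qed
  moreover have "?I" if "?II" using that by blast
  moreover have "?III" if I: "?I"
  proof (intro allI impI, elim conjE)
    fix \<rho> assume \<rho>: "quantum_state n \<rho>" and sub: "supp \<rho> \<subseteq> supp \<sigma>"
    have \<rho>p: "psd n \<rho>" and \<rho>c: "\<rho> \<in> carrier_mat n n"
      using \<rho> by (auto simp: quantum_state_def psd_def)
    have X: "\<rho> - \<sigma> \<in> carrier_mat n n" using \<sigma>c by (intro minus_carrier_mat)
    obtain c where c: "c > 0" "psd n (\<sigma> - complex_of_real c \<cdot>\<^sub>m \<rho>)"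
      using dominated_iff_supp[OF \<rho>p \<sigma>p] sub unfolding dominated_def by blast
    obtain CM where CM: "\<And>\<tau> t. quantum_state n \<tau> \<Longrightarrow> supp \<tau> \<subseteq> supp \<sigma> \<Longrightarrow>
        \<tau> = \<sigma> - complex_of_real t \<cdot>\<^sub>m (\<rho> - \<sigma>) \<Longrightarrow> 0 \<le> DM \<tau> \<and> DM \<tau> \<le> CM * t\<^sup>2"
      using positive_tp_map_rel_entropy_second_order[OF FM \<sigma> X] unfolding DM_def by blast
    obtain CN where CN: "\<And>\<tau> t. quantum_state n \<tau> \<Longrightarrow> supp \<tau> \<subseteq> supp \<sigma> \<Longrightarrow>
        \<tau> = \<sigma> - complex_of_real t \<cdot>\<^sub>m (\<rho> - \<sigma>) \<Longrightarrow> 0 \<le> DN \<tau> \<and> DN \<tau> \<le> CN * t\<^sup>2"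
      using positive_tp_map_rel_entropy_second_order[OF FN \<sigma> X] unfolding DN_def by blast
    obtain CR where CR: "\<And>\<tau> t. quantum_state n \<tau> \<Longrightarrow> supp \<tau> \<subseteq> supp \<sigma> \<Longrightarrow>
        \<tau> = \<sigma> - complex_of_real t \<cdot>\<^sub>m (\<rho> - \<sigma>) \<Longrightarrow> 0 \<le> DR \<tau> \<and> DR \<tau> \<le> CR * t\<^sup>2"
      using positive_tp_map_rel_entropy_second_order[OF FR \<sigma> X] unfolding DR_def by blast
    \<comment> \<open>Only \<open>CM\<close> and \<open>CR\<close> enter: \<open>DN\<close> and the
      \<eta>-multiple of \<open>DR\<close> occur in \<open>G\<close> with a minus sign and are
      bounded below by 0. The absolute value and the summand 1 make \<open>K\<close>
      positive.\<close>
    define K where "K = \<bar>\<eta> * CM + CR\<bar> + 1"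
    \<comment> \<open>From \<open>l * G \<rho> + (1 - l) * G \<tau> \<ge> 0\<close>,
      \<open>G \<tau> \<le> K * t\<^sup>2\<close> and \<open>(1 - l) * t = l\<close> follows
      \<open>G \<rho> \<ge> - K * t\<close>; for \<open>l \<le> 1 / 2\<close> one has
      \<open>t \<le> 2 * l\<close>.\<close>
    have bound: "- (2 * l * K) \<le> G \<rho>" if l: "0 < l" "l \<le> c" "l \<le> 1 / 2" for l
    proof -
      define t where "t = l / (1 - l)"
      define \<tau> where "\<tau> = \<sigma> - complex_of_real t \<cdot>\<^sub>m (\<rho> - \<sigma>)"
      define p where "p = (\<lambda>u :: nat. if u = 0 then l else 1 - l)"
      define \<tau>s where "\<tau>s = (\<lambda>u :: nat. if u = 0 then \<rho> else \<tau>)"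
      have \<tau>: "quantum_state n \<tau>" and mix: "mixture 2 n p \<tau>s = \<sigma>"
        using state_decomposition[OF \<sigma> \<rho> c(2) l(1,2)] l unfolding \<tau>_def t_def p_def \<tau>s_def by auto
      have p: "p u \<ge> 0" for u using l by (simp add: p_def)
      have \<tau>s: "quantum_state n (\<tau>s u)" for u using \<rho> \<tau> by (simp add: \<tau>s_def)
      then have ps: "psd n (\<tau>s u)" for u by (simp add: quantum_state_def)
      \<comment> \<open>\<tau> is a member of the mixture \<sigma> with weight
        \<open>1 - l > 0\<close>.\<close>
      have "supp (\<tau>s 1) \<subseteq> supp \<sigma>"
        using supp_subset_mixture[of 2 p n \<tau>s 1, OF p ps] l mix by (simp add: p_def)
      then have sub': "supp \<tau> \<subseteq> supp \<sigma>" by (simp add: \<tau>s_def)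
      note onb = orthonormal_basis_unit_vec[of 2]
      have "cq_state 2 n (cq_mat 2 n (unit_vec 2) p \<tau>s)"
        unfolding cq_state_iff using onb p \<tau>s
        by (intro exI[of _ "unit_vec 2"] exI[of _ p] exI[of _ \<tau>s]) (auto simp: p_def numeral_2_eq_2)
      moreover have "ptrace_fst 2 n (cq_mat 2 n (unit_vec 2) p \<tau>s) = \<sigma>"
        using ptrace_fst_cq_mat[OF onb quantum_state_carrier[OF \<tau>s]] mix by simp
      ultimately have "(\<Sum>u<2. p u * G (\<tau>s u)) \<ge> 0"
        using I cq[OF onb p \<tau>s mix] by blast
      then have "0 \<le> l * G \<rho> + (1 - l) * G \<tau>"
        by (simp add: p_def \<tau>s_def numeral_2_eq_2)
      moreover have "G \<tau> \<le> K * t\<^sup>2"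
      proof -
        have "G \<tau> \<le> \<eta> * DM \<tau> + DR \<tau>"
          using CN[OF \<tau> sub' \<tau>_def] CR[OF \<tau> sub' \<tau>_def] \<eta> by (simp add: G_def algebra_simps)
        also have "\<dots> \<le> \<eta> * (CM * t\<^sup>2) + CR * t\<^sup>2"
          using CM[OF \<tau> sub' \<tau>_def] CR[OF \<tau> sub' \<tau>_def] \<eta> by (intro add_mono mult_left_mono) auto
        also have "\<dots> = (\<eta> * CM + CR) * t\<^sup>2" by (simp add: algebra_simps)
        also have "\<dots> \<le> K * t\<^sup>2" by (intro mult_right_mono) (auto simp: K_def)
        finally show ?thesis .
      qed
      then have "(1 - l) * G \<tau> \<le> (1 - l) * (K * t\<^sup>2)"
        using l by (intro mult_left_mono) auto
      moreover have "(1 - l) * (K * t\<^sup>2) = l * (K * t)"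
        using l by (simp add: t_def power2_eq_square)
      ultimately have "0 \<le> l * (G \<rho> + K * t)"
        by (simp add: algebra_simps)
      then have "0 \<le> G \<rho> + K * t"
        using l by (simp add: zero_le_mult_iff)
      moreover have "K * t \<le> K * (2 * l)"
        using l by (intro mult_left_mono) (auto simp: t_def K_def field_simps)
      ultimately show ?thesis by (simp add: mult_ac)
    qed
    show "G \<rho> \<ge> 0"
    proof (rule field_le_epsilon)
      fix \<epsilon> :: real assume \<epsilon>: "\<epsilon> > 0"
      have K: "K > 0" by (simp add: K_def add_nonneg_pos)
      \<comment> \<open>Small enough for \<sigma> - l \<rho> to be positive semidefinite, for
        \<open>t \<le> 2 * l\<close>, and for the error \<open>2 * l * K\<close> to be at most
        \<epsilon>.\<close>
      define l where "l = min (min c (1 / 2)) (\<epsilon> / (2 * K))"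
      have l: "0 < l" "l \<le> c" "l \<le> 1 / 2" "l \<le> \<epsilon> / (2 * K)"
        using c \<epsilon> K by (auto simp: l_def)
      have "2 * l * K \<le> \<epsilon>" using l(4) K by (simp add: field_simps)
      with bound[OF l(1-3)] show "0 \<le> G \<rho> + \<epsilon>" by linarith
    qed
  qed
  ultimately have "(?I \<longleftrightarrow> ?II) \<and> (?II \<longleftrightarrow> ?III)" by blast
  then show ?thesis
    unfolding n_def[symmetric] using iii by (simp cong: conj_cong imp_cong)
qed

end
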